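(* Let $n,m,p\ge 1$ be integers, let $f_p:\mathbb{R}^n\times\mathbb{R}\times\mathbb{R}^p\to\mathbb{R}^n$ and $f_c:\mathbb{R}^m\times\mathbb{R}\to\mathbb{R}^m$, let $G_p\in\mathbb{R}^{1\times n}$, and let $k_1,k_2\in\mathbb{R}$ with $k_1<k_2$. Let $$S=\{(e,u)\in\mathbb{R}^2\mid (u-k_1e)(u-k_2e)\le 0\},\qquad \mathcal{S}=\{\xi=(x,z)\in\mathbb{R}^{n+m}\mid (G_px,z_1)\in S\},$$ $$\mathcal{E}=\{0\}\times\mathbb{R}^m\subseteq\mathbb{R}^{n+m},\qquad f(\xi,w)=(f_p(x,z_1,w),f_c(z,G_px))\ \text{ for } \xi=(x,z),$$ and assume that $f$ is continuous. Then for each $w\in PC$ and each $\xi_0\in\mathcal{S}$ there is a $T>0$ such that a Carathéodory solution $\xi$ exists on $[0,T]$ to $$\dot\xi=\Pi_{\mathcal{S},\mathcal{E}}(\xi,f(\xi,w(t)))$$ with $\xi(0)=\xi_0$ and input $w$. Moreover, if there is an $M>0$ such that $$\|f(\xi,w)\|\le M(1+\|(\xi,w)\|)\quad\text{for all }\xi\in\mathcal{S}\text{ and all } w\in\mathbb{R}^p,$$ then for each initial state $\xi_0\in\mathcal{S}$ and each bounded $w\in PC$ there exists a Carathéodory solution $\xi:[0,\infty)\to\mathbb{R}^{n+m}$ on $[0,\infty)$ to this system with $\xi(0)=\xi_0$ and input $w$.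
   Context: Here $z_1$ is the first component of $z\in\mathbb{R}^m$. Piecewise continuous inputs: $w:[0,\infty)\to\mathbb{R}^p$ belongs to $PC$ if there is $\{t_k\}_{k\in\mathbb{N}}\subset[0,\infty)$ with $t_0=0$, $t_{k+1}>t_k$ for all $k\in\mathbb{N}$, $\lim_{k\to\infty}t_k=\infty$, such that $w$ is continuous at all $t\notin\{t_k\}_{k\in\mathbb{N}}$ and $\lim_{t\downarrow t_k}w(t)=w(t_k)$ for all $k\in\mathbb{N}$. Tangent cone: for a set $C\subseteq\mathbb{R}^N$ and $x\in C$, $T_C(x)$ is the set of all $v\in\mathbb{R}^N$ for which there exist sequences $\{x_i\}_{i\in\mathbb{N}}\subseteq C$ and $\{\tau_i\}_{i\in\mathbb{N}}$ with $\tau_i>0$, $x_i\to x$, $\tau_i\downarrow 0$, and $v=\lim_{i\to\infty}(x_i-x)/\tau_i$. Projection operator: for $\xi\in\mathcal{S}$ and $v\in\mathbb{R}^{n+m}$, $\Pi_{\mathcal{S},\mathcal{E}}(\xi,v)=\operatorname{argmin}_{w'\in T_{\mathcal{S}}(\xi),\ w'-v\in\mathcal{E}}\|w'-v\|$ (Euclidean norm); in this setting the minimizer exists and is unique, and $\Pi_{\mathcal{S},\mathcal{E}}(\xi,v)$ denotes it. Carathéodory solution on $[0,T]$ for input $w$: a function $\xi:[0,T]\to\mathbb{R}^{n+m}$ that is absolutely continuous, satisfies $\dot\xi(t)=\Pi_{\mathcal{S},\mathcal{E}}(\xi(t),f(\xi(t),w(t)))$ for almost all $t\in[0,T]$, and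 satisfies $\xi(t)\in\mathcal{S}$ for all $t\in[0,T]$. A function $\xi:[0,\infty)\to\mathbb{R}^{n+m}$ is a solution on $[0,\infty)$ if its restriction to $[0,T]$ is a solution on $[0,T]$ for each $T>0$. *)

theory Defs
  imports "HOL-Analysis.Analysis"
begin

text \<open>Functions on \<open>[0,\<infinity>)\<close> and \<open>[0,T]\<close> are represented by total functions on the
  reals; every notion below only depends on the values on the relevant interval.\<close>

definition PC :: "(real \<Rightarrow> 'b::topological_space) set" where
  "PC = {w. \<exists>t :: nat \<Rightarrow> real.
     t 0 = 0 \<and> (\<forall>k. t k < t (Suc k)) \<and> filterlim t at_top sequentially \<and>
     (\<forall>s\<in>{0..} - range t. continuous (at s within {0..}) w) \<and>
     (\<forall>k. (w \<longlongrightarrow> w (t k)) (at_right (t k)))}"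

definition tangent_cone :: "'a::real_normed_vector set \<Rightarrow> 'a \<Rightarrow> 'a set" where
  "tangent_cone C x = {v. \<exists>(X :: nat \<Rightarrow> 'a) (\<tau> :: nat \<Rightarrow> real).
     (\<forall>i. X i \<in> C) \<and> (\<forall>i. \<tau> i > 0) \<and> X \<longlonglongrightarrow> x \<and> \<tau> \<longlonglongrightarrow> 0 \<and>
     (\<lambda>i. (X i - x) /\<^sub>R \<tau> i) \<longlonglongrightarrow> v}"

text \<open>Where the minimizer fails to exist or is not unique, the value is an arbitrary choice; for
  the sector constraints below it always exists and is unique.\<close>

definition ext_proj :: "'a::real_normed_vector set \<Rightarrow> 'a set \<Rightarrow> 'a \<Rightarrow> 'a \<Rightarrow> 'a" where
  "ext_proj C E \<xi> v = (ARG_MIN (\<lambda>w'. norm (w' - v)) w'. w' \<in> tangent_cone C \<xi> \<and> w' - v \<in> E)"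

text \<open>A pair \<open>(s, t)\<close> in \<open>I\<close> stands for the interval with endpoints \<open>s < t\<close>; intervals of one family
  may share endpoints.\<close>

definition absolutely_continuous_on :: "real set \<Rightarrow> (real \<Rightarrow> 'a::real_normed_vector) \<Rightarrow> bool" where
  "absolutely_continuous_on A \<xi> \<longleftrightarrow>
     (\<forall>\<epsilon>>0. \<exists>\<delta>>0. \<forall>I :: (real \<times> real) set.
        finite I \<and> (\<forall>(s, t)\<in>I. s < t \<and> {s..t} \<subseteq> A) \<and>
        pairwise (\<lambda>(s, t) (s', t'). {s<..<t} \<inter> {s'<..<t'} = {}) I \<and>
        (\<Sum>(s, t)\<in>I. t - s) < \<delta>
        \<longrightarrow> (\<Sum>(s, t)\<in>I. norm (\<xi> t - \<xi> s)) < \<epsilon>)"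

definition caratheodory_solution_on ::
  "'a::real_normed_vector set \<Rightarrow> 'a set \<Rightarrow> ('a \<Rightarrow> 'b \<Rightarrow> 'a) \<Rightarrow> (real \<Rightarrow> 'b) \<Rightarrow> real \<Rightarrow> (real \<Rightarrow> 'a) \<Rightarrow> bool"
where
  "caratheodory_solution_on C E f w T \<xi> \<longleftrightarrow>
     absolutely_continuous_on {0..T} \<xi> \<and>
     (AE t in lebesgue_on {0..T}.
        (\<xi> has_vector_derivative ext_proj C E (\<xi> t) (f (\<xi> t) (w t))) (at t within {0..T})) \<and>
     (\<forall>t\<in>{0..T}. \<xi> t \<in> C)"

definition caratheodory_solution ::
  "'a::real_normed_vector set \<Rightarrow> 'a set \<Rightarrow> ('a \<Rightarrow> 'b \<Rightarrow> 'a) \<Rightarrow> (real \<Rightarrow> 'b) \<Rightarrow> (real \<Rightarrow> 'a) \<Rightarrow> bool"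
where
  "caratheodory_solution C E f w \<xi> \<longleftrightarrow> (\<forall>T>0. caratheodory_solution_on C E f w T \<xi>)"

text \<open>The index type carries a linear order, so that ``first component'' makes sense for
  every dimension.\<close>

definition first_component :: "real ^ 'm::{finite,linorder} \<Rightarrow> real" where
  "first_component z = z $ Min UNIV"

definition sector :: "real \<Rightarrow> real \<Rightarrow> (real \<times> real) set" where
  "sector k1 k2 = {(e, u). (u - k1 * e) * (u - k2 * e) \<le> 0}"

text \<open>The state space \<open>\<real>\<^sup>n\<^sup>+\<^sup>m\<close> is the product of \<open>\<real>\<^sup>n\<close> and \<open>\<real>\<^sup>m\<close>, whose norm is the Euclidean one.
  The output matrix is a \<open>1 \<times> n\<close> matrix; its product with a vector has the single entry \<open>$ 1\<close>.\<close>

definition sector_states ::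
  "real ^ 'n ^ 1 \<Rightarrow> real \<Rightarrow> real \<Rightarrow> ((real ^ 'n) \<times> (real ^ 'm::{finite,linorder})) set" where
  "sector_states Gp k1 k2 = {(x, z). ((Gp *v x) $ 1, first_component z) \<in> sector k1 k2}"

definition controller_directions :: "((real ^ 'n) \<times> (real ^ 'm)) set" where
  "controller_directions = {0} \<times> UNIV"

definition closed_loop ::
  "(real ^ 'n \<Rightarrow> real \<Rightarrow> real ^ 'p \<Rightarrow> real ^ 'n) \<Rightarrow>
   (real ^ 'm::{finite,linorder} \<Rightarrow> real \<Rightarrow> real ^ 'm::{finite,linorder}) \<Rightarrow> real ^ 'n ^ 1 \<Rightarrow>
   (real ^ 'n) \<times> (real ^ 'm::{finite,linorder}) \<Rightarrow> real ^ 'p \<Rightarrow> (real ^ 'n) \<times> (real ^ 'm::{finite,linorder})" where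
  "closed_loop fp fc Gp = (\<lambda>(x, z) w. (fp x (first_component z) w, fc z ((Gp *v x) $ 1)))"

end

theory Submission
  imports Defs "HOL-Complex_Analysis.Great_Picard"
begin

text \<open>
  The constraint concerns the two numbers \<open>e = G\<^sub>p x\<close> and \<open>u = z\<^sub>1\<close> only: it says that \<open>u\<close> lies in
  the interval between \<open>k\<^sub>1 e\<close> and \<open>k\<^sub>2 e\<close>, whose end points \<open>lower e\<close> and \<open>upper e\<close> are Lipschitz
  in \<open>e\<close>.  The corrections that the projection may apply leave \<open>e\<close> unchanged, and the one of least
  norm acts on the coordinate \<open>u\<close> alone.  So the system is an ordinary differential equation
  coupled with a sweeping process: the scalar \<open>u\<close> follows its drift and is pushed by the end points
  of a moving interval.  The locale \<open>sector_system\<close> keeps just this structure: a Euclidean space, a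
  unit vector \<open>a\<close> with \<open>u = a \<bullet> \<xi>\<close>, and a vector \<open>q\<close> with \<open>e = q \<bullet> \<xi>\<close>, orthogonal to the
  admissible corrections.

  Existence is a compactness argument, as the field is merely continuous.  Moreau's catching-up
  scheme freezes the state in the field during a time step, integrates, and clips \<open>u\<close> back into its
  interval.  Clipping is Lipschitz, so for a bounded field the resulting paths are equi-Lipschitz,
  and the Arzela-Ascoli theorem provides a uniform limit (\<open>reflected_motion_exists\<close>).  Derivatives
  are lost in this limit, but three properties of the scheme survive (\<open>reflected_motion\<close>): the
  integral equation holds in all directions other than \<open>a\<close>; while \<open>u\<close> stays above its lower
  bound, it grows at most by the integral of its drift; while it stays below its upper bound, it
  grows at least by that integral.

  These three properties already fix the derivative at all but countably many times
  (\<open>reflected_motion_derivative\<close>).  Strictly between the bounds the two inequalities make \<open>u\<close> an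
  integral of its drift.  The gap \<open>D \<ge> 0\<close> between \<open>u\<close> and one of its bounds follows
  the drift while it is positive, so at a contact \<open>D' = 0\<close>, unless the gap was positive during a
  whole interval before the contact (\<open>contact_derivative\<close>); such times are countable (\<open>countable_left_isolated\<close>).  At the corner \<open>e = 0\<close> of the sector the same exception leaves
  only times with \<open>e' = 0\<close>, and then \<open>u' = 0\<close> because \<open>\<bar>u\<bar>\<close> is bounded by a multiple of \<open>\<bar>e\<bar>\<close>.  A
  derivative of a trajectory that stays in the sector is a tangent vector, so to recognise it as the
  projected field it remains to check the obtuse-angle condition \<open>ext_proj_eqI\<close>.

  A field that is bounded near the initial state is reduced to a bounded one by saturating its
  values, which has no effect as long as the solution stays near.  Under linear growth, a ball of
  radius \<open>1 + \<parallel>\<xi>\<^sub>0\<parallel>\<close> around \<open>\<xi>\<^sub>0\<close> only admits speeds of the order \<open>1 + \<parallel>\<xi>\<^sub>0\<parallel>\<close>; hence the local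
  existence time does not depend on \<open>\<xi>\<^sub>0\<close>, and local solutions can be glued for ever.
\<close>

section \<open>Lipschitz functions and left-isolated points\<close>

lemma lipschitz_on_imp_absolutely_continuous_on:
  assumes "L-lipschitz_on A f"
  shows "absolutely_continuous_on A f"
  unfolding absolutely_continuous_on_def
proof (intro allI impI)
  fix \<epsilon> :: real assume "\<epsilon> > 0"
  have L: "L \<ge> 0" using assms by (rule lipschitz_on_nonneg)
  show "\<exists>\<delta>>0. \<forall>I. finite I \<and> (\<forall>(s, t)\<in>I. s < t \<and> {s..t} \<subseteq> A) \<and>
      pairwise (\<lambda>(s, t) (s', t'). {s<..<t} \<inter> {s'<..<t'} = {}) I \<and>
      (\<Sum>(s, t)\<in>I. t - s) < \<delta> \<longrightarrow> (\<Sum>(s, t)\<in>I. norm (f t - f s)) < \<epsilon>"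
  proof (rule exI[of _ "\<epsilon> / (L + 1)"], intro conjI allI impI)
    show "0 < \<epsilon> / (L + 1)" using \<open>\<epsilon> > 0\<close> L by simp
  next
    fix I :: "(real \<times> real) set"
    assume I: "finite I \<and> (\<forall>(s, t)\<in>I. s < t \<and> {s..t} \<subseteq> A) \<and>
      pairwise (\<lambda>(s, t) (s', t'). {s<..<t} \<inter> {s'<..<t'} = {}) I \<and>
      (\<Sum>(s, t)\<in>I. t - s) < \<epsilon> / (L + 1)"
    have "(\<Sum>(s, t)\<in>I. norm (f t - f s)) \<le> (\<Sum>(s, t)\<in>I. (L + 1) * (t - s))"
    proof (rule sum_mono, clarify)
      fix s t assume "(s, t) \<in> I"
      then have st: "s < t" "{s..t} \<subseteq> A" using I by auto
      then have "t \<in> A" "s \<in> A" by auto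
      then have "norm (f t - f s) \<le> L * (t - s)"
        using lipschitz_onD[OF assms, of t s] st by (simp add: dist_norm)
      then show "norm (f t - f s) \<le> (L + 1) * (t - s)"
        using st by (simp add: algebra_simps)
    qed
    also have "\<dots> = (L + 1) * (\<Sum>(s, t)\<in>I. t - s)"
      by (simp add: sum_distrib_left split_def)
    also have "\<dots> < \<epsilon>"
      using I L by (simp add: field_simps)
    finally show "(\<Sum>(s, t)\<in>I. norm (f t - f s)) < \<epsilon>" .
  qed
qed

text \<open>The gaps to the left of the points of this set are pairwise disjoint open intervals.\<close>

lemma countable_left_isolated:
  fixes Z :: "real set"
  shows "countable {t \<in> Z. \<exists>\<delta>>0. Z \<inter> {t - \<delta><..<t} = {}}"
proof -
  define A where "A = {t \<in> Z. \<exists>\<delta>>0. Z \<inter> {t - \<delta><..<t} = {}}"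
  have "\<forall>t\<in>A. \<exists>\<delta>. \<delta> > 0 \<and> Z \<inter> {t - \<delta><..<t} = {}" by (auto simp: A_def)
  then obtain \<delta> where \<delta>: "\<And>t. t \<in> A \<Longrightarrow> \<delta> t > 0 \<and> Z \<inter> {t - \<delta> t<..<t} = {}"
    by metis
  define gap where "gap t = {t - \<delta> t<..<t}" for t
  have disj: "disjnt (gap s) (gap t)" if "s \<in> A" "t \<in> A" "s < t" for s t
  proof -
    have "s \<in> Z" using that by (simp add: A_def)
    then have "s \<le> t - \<delta> t" using \<delta>[OF \<open>t \<in> A\<close>] that by fastforce
    then show ?thesis by (auto simp: gap_def disjnt_def)
  qed
  have pw: "pairwise disjnt (gap ` A)"
    unfolding pairwise_def
    by (smt (verit) disj disjnt_sym image_iff)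
  have "inj_on gap A"
  proof (rule inj_onI, rule ccontr)
    fix s t assume st: "s \<in> A" "t \<in> A" "gap s = gap t" "s \<noteq> t"
    then have "disjnt (gap s) (gap t)"
      by (metis disj disjnt_sym linorder_neqE_linordered_idom)
    moreover have "gap s \<noteq> {}" using \<delta>[OF \<open>s \<in> A\<close>] by (simp add: gap_def)
    ultimately show False using st by (simp add: disjnt_def)
  qed
  moreover have "countable (gap ` A)"
    by (rule countable_disjoint_open_subsets[OF _ pw]) (auto simp: gap_def)
  ultimately have "countable A" using countable_image_inj_on by blast
  then show ?thesis by (simp add: A_def)
qed

section \<open>Strong derivatives and contact with a barrier\<close>

text \<open>Differentiability with both end points of the increment free to move.  The contact argument below
  compares increments over intervals \<open>[r, s]\<close> next to \<open>t\<close> that do not contain \<open>t\<close>, which the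
  ordinary derivative at \<open>t\<close> does not control.\<close>

definition strong_derivative :: "(real \<Rightarrow> 'a::real_normed_vector) \<Rightarrow> 'a \<Rightarrow> real \<Rightarrow> bool" where
  "strong_derivative f v t \<longleftrightarrow> (\<forall>\<epsilon>>0. \<exists>\<delta>>0. \<forall>r s. t - \<delta> < r \<and> r \<le> s \<and> s < t + \<delta> \<longrightarrow>
     norm (f s - f r - (s - r) *\<^sub>R v) \<le> \<epsilon> * (s - r))"

lemma strong_derivativeD:
  assumes "strong_derivative f v t" "\<epsilon> > 0"
  obtains \<delta> where "\<delta> > 0"
    "\<And>r s. t - \<delta> < r \<Longrightarrow> r \<le> s \<Longrightarrow> s < t + \<delta> \<Longrightarrow> norm (f s - f r - (s - r) *\<^sub>R v) \<le> \<epsilon> * (s - r)"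
  using assms unfolding strong_derivative_def by meson

lemma strong_derivative_integral:
  fixes f :: "real \<Rightarrow> 'a::euclidean_space"
  assumes f: "f integrable_on {a..b}" and t: "a < t" "t < b" and c: "isCont f t"
  shows "strong_derivative (\<lambda>s. integral {a..s} f) (f t) t"
  unfolding strong_derivative_def
proof (intro allI impI)
  fix \<epsilon> :: real assume "\<epsilon> > 0"
  then obtain d where d: "d > 0" "\<And>s. \<bar>s - t\<bar> < d \<Longrightarrow> norm (f s - f t) < \<epsilon>"
    using c unfolding continuous_at_eps_delta dist_norm real_norm_def by meson
  show "\<exists>\<delta>>0. \<forall>r s. t - \<delta> < r \<and> r \<le> s \<and> s < t + \<delta> \<longrightarrow>
     norm (integral {a..s} f - integral {a..r} f - (s - r) *\<^sub>R f t) \<le> \<epsilon> * (s - r)"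
  proof (rule exI[of _ "min d (min (t - a) (b - t))"], intro conjI allI impI)
    show "0 < min d (min (t - a) (b - t))" using d t by simp
  next
    fix r s
    assume rs: "t - min d (min (t - a) (b - t)) < r \<and> r \<le> s \<and> s < t + min d (min (t - a) (b - t))"
    have i: "f integrable_on {a..s}" "f integrable_on {r..s}"
      using rs by (auto intro!: integrable_subinterval_real[OF f])
    have "integral {a..s} f = integral {a..r} f + integral {r..s} f"
      using Henstock_Kurzweil_Integration.integral_combine[of a r s f] rs i by auto
    then have "norm (integral {a..s} f - integral {a..r} f - (s - r) *\<^sub>R f t)
        = norm (integral {r..s} (\<lambda>x. f x - f t))"
      using i rs Henstock_Kurzweil_Integration.integral_diff[of f "{r..s}" "\<lambda>x. f t"]
      by (simp add: integrable_const_ivl)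
    also have "\<dots> \<le> integral {r..s} (\<lambda>x. \<epsilon>)"
    proof (rule integral_norm_bound_integral)
      show "norm (f x - f t) \<le> \<epsilon>" if "x \<in> {r..s}" for x
        using that rs by (intro less_imp_le d) auto
    qed (use i in \<open>auto intro!: integrable_diff\<close>)
    also have "\<dots> = \<epsilon> * (s - r)" using rs by simp
    finally show "norm (integral {a..s} f - integral {a..r} f - (s - r) *\<^sub>R f t) \<le> \<epsilon> * (s - r)" .
  qed
qed

lemma strong_derivative_bounded_linear:
  assumes h: "bounded_linear h" and f: "strong_derivative f v t"
  shows "strong_derivative (\<lambda>s. h (f s)) (h v) t"
  unfolding strong_derivative_def
proof (intro allI impI)
  fix \<epsilon> :: real assume "\<epsilon> > 0"
  interpret h: bounded_linear h by (rule h)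
  obtain K where K: "K > 0" "\<And>x. norm (h x) \<le> norm x * K"
    using h.pos_bounded by blast
  obtain \<delta> where \<delta>: "\<delta> > 0"
    "\<And>r s. t - \<delta> < r \<Longrightarrow> r \<le> s \<Longrightarrow> s < t + \<delta> \<Longrightarrow> norm (f s - f r - (s - r) *\<^sub>R v) \<le> \<epsilon> / K * (s - r)"
    using strong_derivativeD[OF f, of "\<epsilon> / K"] \<open>\<epsilon> > 0\<close> K by auto
  have "norm (h (f s) - h (f r) - (s - r) *\<^sub>R h v) \<le> \<epsilon> * (s - r)"
    if "t - \<delta> < r" "r \<le> s" "s < t + \<delta>" for r s
  proof -
    have "norm (h (f s) - h (f r) - (s - r) *\<^sub>R h v) = norm (h (f s - f r - (s - r) *\<^sub>R v))"
      by (simp add: h.diff h.scaleR)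
    also have "\<dots> \<le> norm (f s - f r - (s - r) *\<^sub>R v) * K" by (rule K)
    also have "\<dots> \<le> (\<epsilon> / K * (s - r)) * K"
      using \<delta>(2)[OF that] K by (intro mult_right_mono) auto
    also have "\<dots> = \<epsilon> * (s - r)" using K by simp
    finally show ?thesis .
  qed
  then show "\<exists>\<delta>>0. \<forall>r s. t - \<delta> < r \<and> r \<le> s \<and> s < t + \<delta> \<longrightarrow>
     norm (h (f s) - h (f r) - (s - r) *\<^sub>R h v) \<le> \<epsilon> * (s - r)"
    using \<delta>(1) by blast
qed

lemma strong_derivative_imp_has_vector_derivative:
  assumes "strong_derivative f v t"
  shows "(f has_vector_derivative v) (at t)"
  unfolding has_vector_derivative_def has_derivative_at_alt
proof (intro conjI allI impI)
  show "bounded_linear (\<lambda>x. x *\<^sub>R v)" by (rule bounded_linear_scaleR_left)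
  fix \<epsilon> :: real assume "0 < \<epsilon>"
  then obtain \<delta> where \<delta>: "\<delta> > 0"
    "\<And>r s. t - \<delta> < r \<Longrightarrow> r \<le> s \<Longrightarrow> s < t + \<delta> \<Longrightarrow> norm (f s - f r - (s - r) *\<^sub>R v) \<le> \<epsilon> * (s - r)"
    using strong_derivativeD[OF assms] by metis
  have "norm (f y - f t - (y - t) *\<^sub>R v) \<le> \<epsilon> * norm (y - t)" if "norm (y - t) < \<delta>" for y
  proof (cases "t \<le> y")
    case True
    then show ?thesis using \<delta>(2)[of t y] \<delta>(1) that by auto
  next
    case False
    have "norm (f y - f t - (y - t) *\<^sub>R v) = norm (f t - f y - (t - y) *\<^sub>R v)"
      by (subst norm_minus_commute) (simp add: algebra_simps)
    then show ?thesis using \<delta>(2)[of y t] \<delta>(1) that False by auto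
  qed
  then show "\<exists>d>0. \<forall>y. norm (y - t) < d \<longrightarrow> norm (f y - f t - (y - t) *\<^sub>R v) \<le> \<epsilon> * norm (y - t)"
    using \<delta>(1) by blast
qed

text \<open>The inequalities of a reflected motion hold on closed intervals free of contact.  Here they are
  extended to intervals that begin or end with a contact.\<close>

lemma increment_le_open_interval:
  fixes f g :: "real \<Rightarrow> real"
  assumes rs: "r < s" and cont: "continuous_on {r..s} f" "continuous_on {r..s} g"
    and le: "\<And>r' s'. r < r' \<Longrightarrow> r' \<le> s' \<Longrightarrow> s' < s \<Longrightarrow> f s' - f r' \<le> g s' - g r'"
  shows "f s - f r \<le> g s - g r"
proof -
  define \<rho> where "\<rho> n = (s - r) / 3 * inverse (real (Suc n))" for n
  have \<rho>: "0 < \<rho> n" "\<rho> n < (s - r) / 2" for n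
  proof -
    have "0 < inverse (real (Suc n))" "inverse (real (Suc n)) \<le> 1" by (auto simp: field_simps)
    then have "0 < \<rho> n" "\<rho> n \<le> (s - r) / 3 * 1"
      using rs unfolding \<rho>_def by (intro mult_pos_pos mult_left_mono; simp)+
    then show "0 < \<rho> n" "\<rho> n < (s - r) / 2" using rs by auto
  qed
  have \<rho>0: "\<rho> \<longlonglongrightarrow> 0"
    unfolding \<rho>_def by (rule tendsto_mult_right_zero[OF LIMSEQ_inverse_real_of_nat])
  have l: "(\<lambda>n. h (s - \<rho> n) - h (r + \<rho> n)) \<longlonglongrightarrow> h s - h r"
    if "continuous_on {r..s} h" for h :: "real \<Rightarrow> real"
  proof (rule tendsto_diff)
    have "(\<lambda>n. s - \<rho> n) \<longlonglongrightarrow> s - 0" "(\<lambda>n. r + \<rho> n) \<longlonglongrightarrow> r + 0"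
      by (intro tendsto_intros \<rho>0)+
    then have *: "(\<lambda>n. s - \<rho> n) \<longlonglongrightarrow> s" "(\<lambda>n. r + \<rho> n) \<longlonglongrightarrow> r" by simp_all
    have m: "s - \<rho> n \<in> {r..s}" "r + \<rho> n \<in> {r..s}" for n
      using \<rho>[of n] by (auto simp: field_simps)
    show "(\<lambda>n. h (s - \<rho> n)) \<longlonglongrightarrow> h s"
      by (rule continuous_on_tendsto_compose[OF that *(1)]) (use rs m in auto)
    show "(\<lambda>n. h (r + \<rho> n)) \<longlonglongrightarrow> h r"
      by (rule continuous_on_tendsto_compose[OF that *(2)]) (use rs m in auto)
  qed
  show ?thesis
  proof (rule LIMSEQ_le[OF l[OF cont(1)] l[OF cont(2)]], intro exI allI impI)
    fix n
    show "f (s - \<rho> n) - f (r + \<rho> n) \<le> g (s - \<rho> n) - g (r + \<rho> n)"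
      using \<rho>[of n] by (intro le) (auto simp: field_simps)
  qed
qed

text \<open>\<open>D\<close> is the gap to a barrier and \<open>C\<close> the gap that the drift alone would produce: \<open>D\<close> grows at least
  as much as \<open>C\<close>, and exactly as much while it is positive.  If \<open>c > 0\<close>, the drift would have
  opened the gap before time \<open>t\<close>, contradicting \<open>D t = 0\<close>.  If \<open>c < 0\<close>, the gap cannot reopen
  after a contact near \<open>t\<close>, so \<open>D\<close> vanishes from that contact on; as contacts accumulate at \<open>t\<close> from
  the left, \<open>D\<close> vanishes on both sides of \<open>t\<close>.  If \<open>c = 0\<close>, the increments of \<open>C\<close> near \<open>t\<close> are small
  compared with the length of the interval, and hence so is \<open>D\<close>, by comparison with a contact between
  \<open>t\<close> and the given time, or with \<open>t\<close> itself.\<close>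

lemma contact_derivative:
  fixes D C :: "real \<Rightarrow> real"
  assumes C: "strong_derivative C c t" and \<delta>: "\<delta> > 0"
    and cont: "continuous_on {t - \<delta><..<t + \<delta>} D"
    and nonneg: "\<And>s. t - \<delta> < s \<Longrightarrow> s < t + \<delta> \<Longrightarrow> 0 \<le> D s"
    and zero: "D t = 0"
    and ge: "\<And>r s. t - \<delta> < r \<Longrightarrow> r \<le> s \<Longrightarrow> s < t + \<delta> \<Longrightarrow> C s - C r \<le> D s - D r"
    and le: "\<And>r s. t - \<delta> < r \<Longrightarrow> r < s \<Longrightarrow> s < t + \<delta> \<Longrightarrow> (\<And>x. r < x \<Longrightarrow> x < s \<Longrightarrow> 0 < D x) \<Longrightarrow>
               D s - D r \<le> C s - C r"
    and acc: "\<And>\<eta>. \<eta> > 0 \<Longrightarrow> \<exists>r. t - \<eta> < r \<and> r < t \<and> D r = 0"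
  shows "c \<le> 0" "(D has_vector_derivative 0) (at t)"
proof -
  show c: "c \<le> 0"
  proof (rule ccontr)
    assume "\<not> c \<le> 0"
    then obtain d where d: "d > 0"
      "\<And>r s. t - d < r \<Longrightarrow> r \<le> s \<Longrightarrow> s < t + d \<Longrightarrow> norm (C s - C r - (s - r) *\<^sub>R c) \<le> c / 2 * (s - r)"
      using strong_derivativeD[OF C, of "c / 2"] by auto
    define r where "r = t - min d \<delta> / 2"
    have r: "t - d < r" "t - \<delta> < r" "r < t" using d \<delta> by (auto simp: r_def min_def)
    have "norm (C t - C r - (t - r) *\<^sub>R c) \<le> c / 2 * (t - r)" using r d by (intro d(2)) auto
    then have "- (c / 2 * (t - r)) \<le> C t - C r - (t - r) * c"
      unfolding real_norm_def abs_le_iff real_scaleR_def by linarith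
    then have "c / 2 * (t - r) \<le> C t - C r" by (simp add: field_simps)
    moreover have "C t - C r \<le> D t - D r" using r \<delta> by (intro ge) auto
    moreover have "0 \<le> D r" using r \<delta> by (intro nonneg) auto
    moreover have "0 < c / 2 * (t - r)" using \<open>\<not> c \<le> 0\<close> r by (intro mult_pos_pos) auto
    ultimately show False using zero by linarith
  qed
  have last_zero: "\<exists>r. r0 \<le> r \<and> r \<le> s \<and> D r = 0 \<and> (\<forall>x. r < x \<longrightarrow> x < s \<longrightarrow> 0 < D x)"
    if r0: "t - \<delta> < r0" "r0 \<le> s" "s < t + \<delta>" "D r0 = 0" for r0 s
  proof -
    have "continuous_on {r0..s} D" using r0 by (intro continuous_on_subset[OF cont]) auto
    then have "closed ({r0..s} \<inter> D -` {0})"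
      by (rule continuous_closed_preimage) auto
    then have "compact ({r0..s} \<inter> ({r0..s} \<inter> D -` {0}))"
      by (intro compact_Int_closed) auto
    moreover have "{r0..s} \<inter> ({r0..s} \<inter> D -` {0}) \<noteq> {}" using r0 by auto
    ultimately obtain r where r: "r \<in> {r0..s} \<inter> ({r0..s} \<inter> D -` {0})"
      "\<forall>x\<in>{r0..s} \<inter> ({r0..s} \<inter> D -` {0}). x \<le> r"
      using compact_attains_sup by metis
    have "0 < D x" if "r < x" "x < s" for x
    proof -
      have "x \<in> {r0..s}" "0 \<le> D x" using that r(1) r0 by (auto intro!: nonneg)
      moreover have "D x \<noteq> 0" using r(2) that \<open>x \<in> {r0..s}\<close> by force
      ultimately show ?thesis by simp
    qed
    then show ?thesis using r by (intro exI[of _ r]) auto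
  qed
  show "(D has_vector_derivative 0) (at t)"
    unfolding has_vector_derivative_def has_derivative_at_alt
  proof (intro conjI allI impI)
    show "bounded_linear (\<lambda>x. x *\<^sub>R (0::real))" by (rule bounded_linear_scaleR_left)
    fix \<epsilon> :: real assume \<epsilon>: "0 < \<epsilon>"
    \<comment> \<open>With this tolerance \<open>C\<close> is nonincreasing near \<open>t\<close> when \<open>c < 0\<close>.\<close>
    define \<epsilon>' where "\<epsilon>' = (if c = 0 then \<epsilon> else min \<epsilon> (- c))"
    have \<epsilon>': "0 < \<epsilon>'" "\<epsilon>' \<le> \<epsilon>" "c < 0 \<Longrightarrow> c + \<epsilon>' \<le> 0" using \<epsilon> c by (auto simp: \<epsilon>'_def)
    obtain d0 where d0: "d0 > 0"
      "\<And>r s. t - d0 < r \<Longrightarrow> r \<le> s \<Longrightarrow> s < t + d0 \<Longrightarrow> norm (C s - C r - (s - r) *\<^sub>R c) \<le> \<epsilon>' * (s - r)"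
      using strong_derivativeD[OF C \<epsilon>'(1)] by metis
    define d where "d = min d0 \<delta>"
    have d: "d > 0" "d \<le> d0" "d \<le> \<delta>" using d0 \<delta> by (auto simp: d_def)
    have inc: "C s - C r \<le> (c + \<epsilon>') * (s - r)" "(c - \<epsilon>') * (s - r) \<le> C s - C r"
      if "t - d < r" "r \<le> s" "s < t + d" for r s
      using d0(2)[of r s] that d by (auto simp: abs_le_iff algebra_simps)
    have after_zero: "\<exists>r. r0 \<le> r \<and> r \<le> s \<and> D s \<le> (c + \<epsilon>') * (s - r)"
      if r0: "t - d < r0" "r0 \<le> s" "s < t + d" "D r0 = 0" for r0 s
    proof -
      obtain r where r: "r0 \<le> r" "r \<le> s" "D r = 0" "\<forall>x. r < x \<longrightarrow> x < s \<longrightarrow> 0 < D x"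
        using last_zero[of r0 s] r0 d by auto
      have "D s \<le> (c + \<epsilon>') * (s - r)"
      proof (cases "r = s")
        case False
        then have "D s - D r \<le> C s - C r" using r r0 d by (intro le) auto
        also have "\<dots> \<le> (c + \<epsilon>') * (s - r)" using r r0 by (intro inc) auto
        finally show ?thesis using r by simp
      qed (use r in simp)
      then show ?thesis using r by blast
    qed
    have right: "D s \<le> \<epsilon> * (s - t)" if s: "t \<le> s" "s < t + d" for s
    proof -
      obtain r where r: "t \<le> r" "r \<le> s" "D s \<le> (c + \<epsilon>') * (s - r)"
        using after_zero[of t s] s d zero by auto
      have "(c + \<epsilon>') * (s - r) \<le> \<epsilon> * (s - r)"
        using c \<epsilon>' r by (intro mult_right_mono) auto
      also have "\<dots> \<le> \<epsilon> * (s - t)" using \<epsilon> r by (intro mult_left_mono) auto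
      finally show ?thesis using r by simp
    qed
    have "\<exists>d'>0. \<forall>s. t - d' < s \<longrightarrow> s < t \<longrightarrow> D s \<le> \<epsilon> * (t - s)"
    proof (cases "c = 0")
      case True
      have "D s \<le> \<epsilon> * (t - s)" if "t - d < s" "s < t" for s
      proof -
        have "- \<epsilon>' * (t - s) \<le> C t - C s" using inc(2)[of s t] that d True by simp
        also have "\<dots> \<le> D t - D s" using that d by (intro ge) auto
        finally show ?thesis using True zero by (simp add: \<epsilon>'_def)
      qed
      then show ?thesis using d by blast
    next
      case False
      obtain r0 where r0: "t - d < r0" "r0 < t" "D r0 = 0" using acc[OF d(1)] by blast
      have "D s \<le> \<epsilon> * (t - s)" if s: "t - (t - r0) < s" "s < t" for s
      proof -
        obtain r where r: "r0 \<le> r" "r \<le> s" "D s \<le> (c + \<epsilon>') * (s - r)"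
          using after_zero[of r0 s] s r0 d by auto
        have "(c + \<epsilon>') * (s - r) \<le> 0"
          using False c \<epsilon>'(3) r by (intro mult_nonpos_nonneg) auto
        also have "0 \<le> \<epsilon> * (t - s)" using \<epsilon> s by simp
        finally show ?thesis using r by simp
      qed
      then show ?thesis using r0 by (intro exI[of _ "t - r0"]) auto
    qed
    then obtain d' where d': "d' > 0" "\<And>s. t - d' < s \<Longrightarrow> s < t \<Longrightarrow> D s \<le> \<epsilon> * (t - s)" by blast
    have "norm (D y - D t - (y - t) *\<^sub>R 0) \<le> \<epsilon> * norm (y - t)" if "norm (y - t) < min d d'" for y
    proof -
      have "0 \<le> D y" using that d by (intro nonneg) auto
      then show ?thesis using right[of y] d'(2)[of y] that zero by (cases "t \<le> y") auto
    qed
    then show "\<exists>d>0. \<forall>y. norm (y - t) < d \<longrightarrow> norm (D y - D t - (y - t) *\<^sub>R 0) \<le> \<epsilon> * norm (y - t)"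
      using d d' by (intro exI[of _ "min d d'"]) auto
  qed
qed

section \<open>Tangent cones and the extended projection\<close>

text \<open>As the tangent cone is not convex at the corner of the sector, uniqueness of the minimizer is part
  of the claim: the obtuse-angle condition makes \<open>v'\<close> strictly closer to \<open>v\<close> than every other
  competitor.\<close>

lemma ext_proj_eqI:
  fixes v v' :: "'a::real_inner"
  assumes v': "v' \<in> tangent_cone C \<xi>" "v' - v \<in> E"
    and obtuse: "\<And>w. w \<in> tangent_cone C \<xi> \<Longrightarrow> w - v \<in> E \<Longrightarrow> 0 \<le> (w - v') \<bullet> (v' - v)"
  shows "ext_proj C E \<xi> v = v'"
proof -
  have closer: "norm (v' - v) < norm (w - v)"
    if w: "w \<in> tangent_cone C \<xi>" "w - v \<in> E" "w \<noteq> v'" for w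
  proof -
    have "(norm (w - v))\<^sup>2 = (norm (w - v'))\<^sup>2 + 2 * ((w - v') \<bullet> (v' - v)) + (norm (v' - v))\<^sup>2"
      by (simp add: power2_norm_eq_inner inner_diff_left inner_diff_right inner_commute algebra_simps)
    moreover have "0 < (norm (w - v'))\<^sup>2" using w by simp
    ultimately have "(norm (v' - v))\<^sup>2 < (norm (w - v))\<^sup>2" using obtuse[OF w(1,2)] by linarith
    then show ?thesis by (rule power_less_imp_less_base) simp
  qed
  let ?P = "\<lambda>w'. w' \<in> tangent_cone C \<xi> \<and> w' - v \<in> E"
  have "is_arg_min (\<lambda>w'. norm (w' - v)) ?P = (\<lambda>w. w = v')"
    unfolding is_arg_min_def fun_eq_iff using closer v' by (metis order_less_irrefl order_less_trans)
  then show ?thesis unfolding ext_proj_def arg_min_def by simp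
qed

lemma derivative_in_tangent_cone:
  fixes f :: "real \<Rightarrow> 'a::real_normed_vector"
  assumes f: "(f has_vector_derivative v) (at t)" and \<delta>: "\<delta> > 0"
    and C: "\<And>s. t \<le> s \<Longrightarrow> s < t + \<delta> \<Longrightarrow> f s \<in> C"
  shows "v \<in> tangent_cone C (f t)"
proof -
  define \<tau> where "\<tau> n = \<delta> / 2 * inverse (real (Suc n))" for n
  have \<tau>: "0 < \<tau> n" "\<tau> n < \<delta>" for n
  proof -
    have "0 < inverse (real (Suc n))" "inverse (real (Suc n)) \<le> 1" by (auto simp: field_simps)
    then have "0 < \<tau> n" "\<tau> n \<le> \<delta> / 2 * 1"
      using \<delta> unfolding \<tau>_def by (intro mult_pos_pos mult_left_mono; simp)+
    then show "0 < \<tau> n" "\<tau> n < \<delta>" using \<delta> by auto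
  qed
  have \<tau>0: "\<tau> \<longlonglongrightarrow> 0"
    unfolding \<tau>_def by (rule tendsto_mult_right_zero[OF LIMSEQ_inverse_real_of_nat])
  have t\<tau>: "(\<lambda>n. t + \<tau> n) \<longlonglongrightarrow> t" using tendsto_add[OF tendsto_const \<tau>0, of t] by simp
  have "isCont f t" using f by (rule has_vector_derivative_continuous)
  then have X: "(\<lambda>n. f (t + \<tau> n)) \<longlonglongrightarrow> f t" using t\<tau> by (rule isCont_tendsto_compose)
  have q: "(\<lambda>n. (f (t + \<tau> n) - f t) /\<^sub>R \<tau> n) \<longlonglongrightarrow> v"
  proof (rule LIMSEQ_I)
    fix \<epsilon> :: real assume "0 < \<epsilon>"
    then obtain d where d: "d > 0" "\<And>y. norm (y - t) < d \<Longrightarrow> norm (f y - f t - (y - t) *\<^sub>R v) \<le> \<epsilon> / 2 * norm (y - t)"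
      using f unfolding has_vector_derivative_def has_derivative_at_alt by (meson half_gt_zero)
    obtain N where N: "\<And>n. n \<ge> N \<Longrightarrow> norm (\<tau> n - 0) < d" using LIMSEQ_D[OF \<tau>0 d(1)] by blast
    have "norm ((f (t + \<tau> n) - f t) /\<^sub>R \<tau> n - v) < \<epsilon>" if "n \<ge> N" for n
    proof -
      have "(f (t + \<tau> n) - f t) /\<^sub>R \<tau> n - v = (f (t + \<tau> n) - f t - \<tau> n *\<^sub>R v) /\<^sub>R \<tau> n"
        using \<tau>(1)[of n] by (simp add: scaleR_diff_right)
      then have "norm ((f (t + \<tau> n) - f t) /\<^sub>R \<tau> n - v) = norm (f (t + \<tau> n) - f t - \<tau> n *\<^sub>R v) / \<tau> n"
        using \<tau>(1)[of n] by (simp add: divide_inverse_commute)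
      also have "\<dots> \<le> (\<epsilon> / 2 * \<tau> n) / \<tau> n"
        using d(2)[of "t + \<tau> n"] N[OF that] \<tau>(1)[of n] by (intro divide_right_mono) auto
      also have "\<dots> < \<epsilon>" using \<tau>(1)[of n] \<open>0 < \<epsilon>\<close> by simp
      finally show ?thesis .
    qed
    then show "\<exists>N. \<forall>n\<ge>N. norm ((f (t + \<tau> n) - f t) /\<^sub>R \<tau> n - v) < \<epsilon>" by blast
  qed
  show ?thesis unfolding tangent_cone_def
    using X \<tau> \<tau>0 q C by (auto intro!: exI[of _ "\<lambda>n. f (t + \<tau> n)"] exI[of _ \<tau>] simp: less_imp_le)
qed

text \<open>A linear functional that attains its maximum over \<open>C\<close>, locally, at \<open>x\<close> cannot grow in a tangent direction.\<close>

lemma tangent_cone_support: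
  fixes p :: "'a::real_inner"
  assumes w: "w \<in> tangent_cone C x"
    and supp: "\<forall>\<^sub>F \<eta> in nhds x. \<eta> \<in> C \<longrightarrow> p \<bullet> \<eta> \<le> p \<bullet> x"
  shows "p \<bullet> w \<le> 0"
proof -
  obtain X \<tau> where X: "\<And>i. X i \<in> C" "\<And>i. \<tau> i > 0" "X \<longlonglongrightarrow> x"
    and lim: "(\<lambda>i::nat. (X i - x) /\<^sub>R \<tau> i) \<longlonglongrightarrow> w"
    using w unfolding tangent_cone_def by blast
  have "(\<lambda>i. p \<bullet> ((X i - x) /\<^sub>R \<tau> i)) \<longlonglongrightarrow> p \<bullet> w" by (intro tendsto_intros lim)
  moreover have "\<forall>\<^sub>F i in sequentially. p \<bullet> ((X i - x) /\<^sub>R \<tau> i) \<le> 0"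
  proof -
    have "\<forall>\<^sub>F i in sequentially. X i \<in> C \<longrightarrow> p \<bullet> X i \<le> p \<bullet> x"
      using X(3) supp unfolding filterlim_iff by blast
    then show ?thesis
    proof eventually_elim
      case (elim i)
      then have "p \<bullet> (X i - x) \<le> 0" using X(1) by (simp add: inner_diff_right)
      then show ?case using X(2)[of i] by (simp add: mult_nonneg_nonpos)
    qed
  qed
  ultimately show ?thesis by (rule tendsto_upperbound) simp
qed

lemma eventually_nhds_real_interval:
  fixes t :: real
  assumes "eventually P (nhds t)"
  obtains \<delta> where "\<delta> > 0" "\<And>s. t - \<delta> < s \<Longrightarrow> s < t + \<delta> \<Longrightarrow> P s"
proof -
  obtain \<delta> where "\<delta> > 0" "\<forall>s. dist s t < \<delta> \<longrightarrow> P s"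
    using assms unfolding eventually_nhds_metric by blast
  then show ?thesis by (intro that[of \<delta>]) (auto simp: dist_real_def)
qed

lemma isCont_eventually_nhds:
  fixes f :: "'b::t2_space \<Rightarrow> 'c::topological_space"
  assumes "isCont f t" "eventually P (nhds (f t))"
  shows "\<forall>\<^sub>F s in nhds t. P (f s)"
  using assms(2)
  by (rule eventually_compose_filterlim) (use assms(1) in \<open>simp add: isCont_def tendsto_at_iff_tendsto_nhds\<close>)

lemma isCont_less_eventually_nhds:
  fixes f g :: "real \<Rightarrow> real"
  assumes "isCont f t" "isCont g t" "f t < g t"
  shows "\<forall>\<^sub>F s in nhds t. f s < g s"
proof -
  have "isCont (\<lambda>s. g s - f s) t" by (intro continuous_intros assms)
  moreover have "\<forall>\<^sub>F x in nhds (g t - f t). x \<in> {0<..}"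
    using assms(3) by (intro eventually_nhds_in_open) auto
  ultimately have "\<forall>\<^sub>F s in nhds t. g s - f s \<in> {0<..}" by (rule isCont_eventually_nhds)
  then show ?thesis by eventually_elim simp
qed

section \<open>Geometry of the sector\<close>

text \<open>The part of the closed loop that matters for the constraint: \<open>u = a \<bullet> \<xi>\<close> is the constrained
  coordinate, \<open>e = q \<bullet> \<xi>\<close> the coordinate that bounds it, and \<open>E\<close> the admissible corrections.\<close>

locale sector_system =
  fixes a q :: "'a::euclidean_space" and E :: "'a set" and k1 k2 :: real
  assumes norm_a: "norm a = 1"
    and axis_in_E: "\<And>c. c *\<^sub>R a \<in> E"
    and q_orthogonal_E: "\<And>y. y \<in> E \<Longrightarrow> q \<bullet> y = 0"
    and k_less: "k1 < k2"
begin

definition lower :: "real \<Rightarrow> real" where "lower e = min (k1 * e) (k2 * e)"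
definition upper :: "real \<Rightarrow> real" where "upper e = max (k1 * e) (k2 * e)"

definition states :: "'a set" where
  "states = {\<xi>. (a \<bullet> \<xi> - k1 * (q \<bullet> \<xi>)) * (a \<bullet> \<xi> - k2 * (q \<bullet> \<xi>)) \<le> 0}"

definition slope_bound :: real where "slope_bound = \<bar>k1\<bar> + \<bar>k2\<bar>"

text \<open>The component on which the projection does not act.\<close>

definition off_axis :: "'a \<Rightarrow> 'a" where "off_axis y = y - (a \<bullet> y) *\<^sub>R a"

lemma a_inner_a: "a \<bullet> a = 1"
  using norm_a by (simp add: norm_eq_1)

lemma q_inner_a: "q \<bullet> a = 0"
  using q_orthogonal_E[OF axis_in_E[of 1]] by simp

lemma states_iff: "\<xi> \<in> states \<longleftrightarrow> lower (q \<bullet> \<xi>) \<le> a \<bullet> \<xi> \<and> a \<bullet> \<xi> \<le> upper (q \<bullet> \<xi>)"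
  unfolding states_def lower_def upper_def by (auto simp: mult_le_0_iff min_def max_def)

lemma closed_states: "closed states"
  unfolding states_def by (intro closed_Collect_le continuous_intros)

lemma slope_bound_nonneg: "0 \<le> slope_bound" by (simp add: slope_bound_def)

lemma lower_lipschitz: "\<bar>lower x - lower y\<bar> \<le> slope_bound * \<bar>x - y\<bar>"
  and upper_lipschitz: "\<bar>upper x - upper y\<bar> \<le> slope_bound * \<bar>x - y\<bar>"
proof -
  have "\<bar>k1 * x - k1 * y\<bar> \<le> slope_bound * \<bar>x - y\<bar>" "\<bar>k2 * x - k2 * y\<bar> \<le> slope_bound * \<bar>x - y\<bar>"
    by (simp_all add: slope_bound_def abs_mult mult_right_mono flip: right_diff_distrib)
  then show "\<bar>lower x - lower y\<bar> \<le> slope_bound * \<bar>x - y\<bar>" "\<bar>upper x - upper y\<bar> \<le> slope_bound * \<bar>x - y\<bar>"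
    unfolding lower_def upper_def by linarith+
qed

lemma continuous_lower: "continuous_on A f \<Longrightarrow> continuous_on A (\<lambda>x. lower (f x))"
  and continuous_upper: "continuous_on A f \<Longrightarrow> continuous_on A (\<lambda>x. upper (f x))"
  unfolding lower_def upper_def by (intro continuous_intros; assumption)+

lemma isCont_lower: "isCont f x \<Longrightarrow> isCont (\<lambda>x. lower (f x)) x"
  and isCont_upper: "isCont f x \<Longrightarrow> isCont (\<lambda>x. upper (f x)) x"
  unfolding lower_def upper_def by (intro continuous_intros; assumption)+

lemma abs_le_slope_bound:
  assumes "lower e \<le> u" "u \<le> upper e"
  shows "\<bar>u\<bar> \<le> slope_bound * \<bar>e\<bar>"
proof -
  have "\<bar>lower e\<bar> \<le> slope_bound * \<bar>e\<bar>" "\<bar>upper e\<bar> \<le> slope_bound * \<bar>e\<bar>"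
    using lower_lipschitz[of e 0] upper_lipschitz[of e 0] by (simp_all add: lower_def upper_def)
  then show ?thesis using assms by linarith
qed

lemma lower_less_upper: "e \<noteq> 0 \<Longrightarrow> lower e < upper e"
  using k_less mult_right_cancel[of e k1 k2] unfolding lower_def upper_def by linarith

text \<open>Moves a state along \<open>a\<close> to the nearest admissible value of \<open>u\<close>.  This keeps \<open>e\<close>, hence the interval
  itself, fixed.\<close>

definition clip :: "'a \<Rightarrow> 'a" where
  "clip \<xi> = \<xi> + (max (lower (q \<bullet> \<xi>)) (min (upper (q \<bullet> \<xi>)) (a \<bullet> \<xi>)) - a \<bullet> \<xi>) *\<^sub>R a"

definition clip_lipschitz :: real where "clip_lipschitz = 3 + 2 * slope_bound * norm q"

lemma q_clip: "q \<bullet> clip \<xi> = q \<bullet> \<xi>"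
  by (simp add: clip_def inner_add_right q_inner_a)

lemma a_clip: "a \<bullet> clip \<xi> = max (lower (q \<bullet> \<xi>)) (min (upper (q \<bullet> \<xi>)) (a \<bullet> \<xi>))"
  by (simp add: clip_def inner_add_right a_inner_a)

lemma lower_le_upper: "lower e \<le> upper e"
  by (auto simp: lower_def upper_def)

lemma clip_in_states: "clip \<xi> \<in> states"
  unfolding states_iff q_clip a_clip using lower_le_upper by auto

lemma clip_ident: "\<xi> \<in> states \<Longrightarrow> clip \<xi> = \<xi>"
  unfolding states_iff clip_def by auto

lemma off_axis_diff: "off_axis (x - y) = off_axis x - off_axis y"
  by (simp add: off_axis_def inner_diff_right algebra_simps)

lemma off_axis_add: "off_axis (x + y) = off_axis x + off_axis y"
  by (simp add: off_axis_def inner_add_right algebra_simps)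

lemma off_axis_clip: "off_axis (clip \<xi>) = off_axis \<xi>"
  by (simp add: off_axis_def clip_def inner_add_right a_inner_a algebra_simps)

lemma clip_lipschitz_ge: "3 \<le> clip_lipschitz"
  using slope_bound_nonneg by (simp add: clip_lipschitz_def)

text \<open>The clipped value of \<open>u\<close> depends on \<open>u\<close> and on both end points with Lipschitz constant \<open>1\<close>, and the
  end points depend on \<open>e\<close> with constant \<open>slope_bound\<close>.\<close>

lemma norm_clip_diff: "norm (clip x - clip y) \<le> clip_lipschitz * norm (x - y)"
proof -
  define c where "c z = max (lower (q \<bullet> z)) (min (upper (q \<bullet> z)) (a \<bullet> z))" for z
  have qd: "\<bar>q \<bullet> x - q \<bullet> y\<bar> \<le> norm q * norm (x - y)"
    using Cauchy_Schwarz_ineq2[of q "x - y"] by (simp add: inner_diff_right)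
  have ad: "\<bar>a \<bullet> x - a \<bullet> y\<bar> \<le> norm (x - y)"
    using Cauchy_Schwarz_ineq2[of a "x - y"] by (simp add: inner_diff_right norm_a)
  have "\<bar>c x - c y\<bar> \<le> \<bar>lower (q \<bullet> x) - lower (q \<bullet> y)\<bar> + \<bar>upper (q \<bullet> x) - upper (q \<bullet> y)\<bar> + \<bar>a \<bullet> x - a \<bullet> y\<bar>"
    unfolding c_def by linarith
  moreover have "slope_bound * \<bar>q \<bullet> x - q \<bullet> y\<bar> \<le> slope_bound * (norm q * norm (x - y))"
    by (rule mult_left_mono[OF qd slope_bound_nonneg])
  ultimately have cd: "\<bar>c x - c y\<bar> \<le> 2 * (slope_bound * (norm q * norm (x - y))) + norm (x - y)"
    using lower_lipschitz[of "q \<bullet> x" "q \<bullet> y"] upper_lipschitz[of "q \<bullet> x" "q \<bullet> y"] ad by linarith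
  have "clip x - clip y = (x - y) + ((c x - c y) - (a \<bullet> x - a \<bullet> y)) *\<^sub>R a"
    by (simp add: clip_def c_def algebra_simps)
  then have "norm (clip x - clip y) \<le> norm (x - y) + \<bar>(c x - c y) - (a \<bullet> x - a \<bullet> y)\<bar>"
    using norm_triangle_ineq[of "x - y" "((c x - c y) - (a \<bullet> x - a \<bullet> y)) *\<^sub>R a"] by (simp add: norm_a)
  also have "\<dots> \<le> norm (x - y) + (2 * (slope_bound * (norm q * norm (x - y))) + norm (x - y) + norm (x - y))"
    using cd ad by linarith
  also have "\<dots> = clip_lipschitz * norm (x - y)"
    by (simp add: clip_lipschitz_def algebra_simps)
  finally show ?thesis .
qed

section \<open>Derivatives of trajectories in the sector\<close>

text \<open>At the corner the sector is a closed cone, so difference quotients remain in it.\<close>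

lemma tangent_cone_corner:
  assumes w: "w \<in> tangent_cone states \<xi>" and \<xi>: "q \<bullet> \<xi> = 0" "a \<bullet> \<xi> = 0"
  shows "w \<in> states"
proof -
  obtain X \<tau> where X: "\<And>i. X i \<in> states" "\<And>i. \<tau> i > 0" "X \<longlonglongrightarrow> \<xi>"
    and lim: "(\<lambda>i::nat. (X i - \<xi>) /\<^sub>R \<tau> i) \<longlonglongrightarrow> w"
    using w unfolding tangent_cone_def by blast
  have "(X i - \<xi>) /\<^sub>R \<tau> i \<in> states" for i
  proof -
    define c where "c = inverse (\<tau> i)"
    have "(a \<bullet> X i - k1 * (q \<bullet> X i)) * (a \<bullet> X i - k2 * (q \<bullet> X i)) \<le> 0"
      using X(1)[of i] by (simp add: states_def)
    then have "c\<^sup>2 * ((a \<bullet> X i - k1 * (q \<bullet> X i)) * (a \<bullet> X i - k2 * (q \<bullet> X i))) \<le> 0"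
      by (rule mult_nonneg_nonpos[OF zero_le_power2])
    moreover have "c\<^sup>2 * ((a \<bullet> X i - k1 * (q \<bullet> X i)) * (a \<bullet> X i - k2 * (q \<bullet> X i))) =
        (c * (a \<bullet> X i) - k1 * (c * (q \<bullet> X i))) * (c * (a \<bullet> X i) - k2 * (c * (q \<bullet> X i)))"
      by (simp add: power2_eq_square algebra_simps)
    ultimately show ?thesis using \<xi> unfolding c_def states_def by (simp add: inner_diff_right)
  qed
  then show ?thesis using closed_sequentially[OF closed_states _ lim] by blast
qed

text \<open>Once \<open>u\<close> is known to be differentiable, the remaining components are given by the integral
  equation.  Tangency comes for free, as the velocity of a curve inside \<open>states\<close>; and since \<open>v\<close> is
  corrected along \<open>a\<close> only, the obtuse-angle condition reduces to a condition on \<open>u\<close>.\<close>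

lemma derivative_of_trajectory:
  assumes \<xi>: "\<And>s. 0 \<le> s \<Longrightarrow> s \<le> T \<Longrightarrow> \<xi> s \<in> states"
    and I: "strong_derivative I v t" and t: "0 < t" "t < T"
    and off: "\<And>s. 0 \<le> s \<Longrightarrow> s \<le> T \<Longrightarrow> off_axis (\<xi> s - \<xi> 0 - I s) = 0"
    and u: "((\<lambda>s. a \<bullet> \<xi> s) has_vector_derivative u') (at t)"
    and obtuse: "\<And>w. w \<in> tangent_cone states (\<xi> t) \<Longrightarrow> q \<bullet> w = q \<bullet> v \<Longrightarrow> 0 \<le> (a \<bullet> w - u') * (u' - a \<bullet> v)"
  shows "(\<xi> has_vector_derivative ext_proj states E (\<xi> t) v) (at t)"
proof -
  define v' where "v' = v + (u' - a \<bullet> v) *\<^sub>R a"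
  have I': "(I has_vector_derivative v) (at t)"
    by (rule strong_derivative_imp_has_vector_derivative[OF I])
  have aI: "((\<lambda>s. a \<bullet> I s) has_vector_derivative a \<bullet> v) (at t)"
    using bounded_linear.has_vector_derivative[OF bounded_linear_inner_right I'] .
  have "((\<lambda>s. (\<xi> 0 - (a \<bullet> \<xi> 0) *\<^sub>R a) + (I s - (a \<bullet> I s) *\<^sub>R a) + (a \<bullet> \<xi> s) *\<^sub>R a)
      has_vector_derivative 0 + (v - (a \<bullet> v) *\<^sub>R a) + u' *\<^sub>R a) (at t)"
    by (intro has_vector_derivative_add has_vector_derivative_const has_vector_derivative_diff I'
        bounded_linear.has_vector_derivative[OF bounded_linear_scaleR_left aI]
        bounded_linear.has_vector_derivative[OF bounded_linear_scaleR_left u])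
  moreover have "\<xi> s = (\<xi> 0 - (a \<bullet> \<xi> 0) *\<^sub>R a) + (I s - (a \<bullet> I s) *\<^sub>R a) + (a \<bullet> \<xi> s) *\<^sub>R a"
    if "s \<in> {0<..<T}" for s
    using off[of s] that by (simp add: off_axis_def inner_diff_right algebra_simps)
  ultimately have der: "(\<xi> has_vector_derivative v') (at t)"
    using has_vector_derivative_transform_within_open[of _ _ t "{0<..<T}" \<xi>] t
    by (simp add: v'_def algebra_simps)
  have "v' \<in> tangent_cone states (\<xi> t)"
    by (rule derivative_in_tangent_cone[OF der, of "T - t"]) (use t \<xi> in auto)
  moreover have "v' - v \<in> E" by (simp add: v'_def axis_in_E)
  moreover have "0 \<le> (w - v') \<bullet> (v' - v)"
    if w: "w \<in> tangent_cone states (\<xi> t)" "w - v \<in> E" for w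
  proof -
    have "q \<bullet> w = q \<bullet> v" using q_orthogonal_E[OF w(2)] by (simp add: inner_diff_right)
    then have "0 \<le> (a \<bullet> w - u') * (u' - a \<bullet> v)" by (rule obtuse[OF w(1)])
    moreover have "a \<bullet> v' = u'" by (simp add: v'_def inner_add_right a_inner_a)
    then have "(w - v') \<bullet> (v' - v) = (a \<bullet> w - u') * (u' - a \<bullet> v)"
      by (subst inner_commute) (simp add: v'_def inner_diff_right inner_add_right a_inner_a algebra_simps)
    ultimately show ?thesis by simp
  qed
  ultimately have "ext_proj states E (\<xi> t) v = v'" by (rule ext_proj_eqI)
  then show ?thesis using der by simp
qed

text \<open>The contact lemma applied to the gap between \<open>u\<close> and an edge \<open>u = k e\<close> of the sector.  The sign \<open>\<sigma>\<close>
  is \<open>1\<close> if the edge bounds \<open>u\<close> from above and \<open>-1\<close> if it bounds \<open>u\<close> from below; this treats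
  all four edges at once.\<close>

lemma derivative_at_constraint:
  fixes k \<sigma> :: real
  assumes I: "strong_derivative I v t" and \<delta>: "\<delta> > 0"
    and cont: "continuous_on {t - \<delta><..<t + \<delta>} \<xi>"
    and q\<xi>: "\<And>s. t - \<delta> < s \<Longrightarrow> s < t + \<delta> \<Longrightarrow> q \<bullet> \<xi> s = q \<bullet> \<xi> 0 + q \<bullet> I s"
    and sign: "\<sigma> * \<sigma> = 1"
    and nonneg: "\<And>s. t - \<delta> < s \<Longrightarrow> s < t + \<delta> \<Longrightarrow> 0 \<le> \<sigma> * (k * (q \<bullet> \<xi> s) - a \<bullet> \<xi> s)"
    and zero: "a \<bullet> \<xi> t = k * (q \<bullet> \<xi> t)"
    and push: "\<And>r s. t - \<delta> < r \<Longrightarrow> r \<le> s \<Longrightarrow> s < t + \<delta> \<Longrightarrow>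
        \<sigma> * (a \<bullet> \<xi> s - a \<bullet> \<xi> r) \<le> \<sigma> * (a \<bullet> I s - a \<bullet> I r)"
    and free: "\<And>r s. t - \<delta> < r \<Longrightarrow> r < s \<Longrightarrow> s < t + \<delta> \<Longrightarrow>
        (\<And>x. r < x \<Longrightarrow> x < s \<Longrightarrow> 0 < \<sigma> * (k * (q \<bullet> \<xi> x) - a \<bullet> \<xi> x)) \<Longrightarrow>
        \<sigma> * (a \<bullet> I s - a \<bullet> I r) \<le> \<sigma> * (a \<bullet> \<xi> s - a \<bullet> \<xi> r)"
    and acc: "\<And>\<eta>. \<eta> > 0 \<Longrightarrow> \<exists>r. t - \<eta> < r \<and> r < t \<and> a \<bullet> \<xi> r = k * (q \<bullet> \<xi> r)"
  shows "\<sigma> * (k * (q \<bullet> v) - a \<bullet> v) \<le> 0"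
    and "((\<lambda>s. a \<bullet> \<xi> s) has_vector_derivative k * (q \<bullet> v)) (at t)"
proof -
  define D where "D s = \<sigma> * (k * (q \<bullet> \<xi> s) - a \<bullet> \<xi> s)" for s
  define p where "p = \<sigma> *\<^sub>R (k *\<^sub>R q - a)"
  have p: "p \<bullet> y = \<sigma> * (k * (q \<bullet> y) - a \<bullet> y)" for y by (simp add: p_def inner_diff_left)
  have pI: "strong_derivative (\<lambda>s. p \<bullet> I s) (p \<bullet> v) t"
    by (rule strong_derivative_bounded_linear[OF bounded_linear_inner_right I])
  have D: "continuous_on {t - \<delta><..<t + \<delta>} D" unfolding D_def by (intro continuous_intros cont)
  have D_nonneg: "0 \<le> D s" if "t - \<delta> < s" "s < t + \<delta>" for s
    using nonneg[OF that] by (simp add: D_def)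
  have D_zero: "D t = 0" using zero by (simp add: D_def)
  have D_push: "p \<bullet> I s - p \<bullet> I r \<le> D s - D r" if "t - \<delta> < r" "r \<le> s" "s < t + \<delta>" for r s
    using push[OF that] q\<xi>[of r] q\<xi>[of s] that by (simp add: D_def p algebra_simps)
  have D_free: "D s - D r \<le> p \<bullet> I s - p \<bullet> I r"
    if "t - \<delta> < r" "r < s" "s < t + \<delta>" "\<And>x. r < x \<Longrightarrow> x < s \<Longrightarrow> 0 < D x" for r s
    using free[of r s] q\<xi>[of r] q\<xi>[of s] that by (simp add: D_def p algebra_simps)
  have D_acc: "\<exists>r. t - \<eta> < r \<and> r < t \<and> D r = 0" if "\<eta> > 0" for \<eta>
    using acc[OF that] by (auto simp: D_def)
  note contact = contact_derivative[OF pI \<delta> D D_nonneg D_zero D_push D_free D_acc]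
  have c: "p \<bullet> v \<le> 0" and D: "(D has_vector_derivative 0) (at t)"
    using contact by blast+
  show "\<sigma> * (k * (q \<bullet> v) - a \<bullet> v) \<le> 0" using c by (simp add: p)
  have qI: "((\<lambda>s. q \<bullet> I s) has_vector_derivative q \<bullet> v) (at t)"
    by (intro bounded_linear.has_vector_derivative[OF bounded_linear_inner_right]
        strong_derivative_imp_has_vector_derivative I)
  have "((\<lambda>s. k * (q \<bullet> \<xi> 0 + q \<bullet> I s) - \<sigma> * D s) has_vector_derivative k * (0 + q \<bullet> v) - \<sigma> * 0) (at t)"
    by (intro has_vector_derivative_diff has_vector_derivative_add has_vector_derivative_const D qI
        bounded_linear.has_vector_derivative[OF bounded_linear_mult_right])
  then have "((\<lambda>s. k * (q \<bullet> \<xi> 0 + q \<bullet> I s) - \<sigma> * D s) has_vector_derivative k * (q \<bullet> v)) (at t)"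
    by simp
  then show "((\<lambda>s. a \<bullet> \<xi> s) has_vector_derivative k * (q \<bullet> v)) (at t)"
  proof (rule has_vector_derivative_transform_within_open[of _ _ t "{t - \<delta><..<t + \<delta>}"])
    fix s assume "s \<in> {t - \<delta><..<t + \<delta>}"
    moreover have "\<sigma> * D s = (\<sigma> * \<sigma>) * (k * (q \<bullet> \<xi> s) - a \<bullet> \<xi> s)" by (simp add: D_def)
    ultimately show "k * (q \<bullet> \<xi> 0 + q \<bullet> I s) - \<sigma> * D s = a \<bullet> \<xi> s" using q\<xi>[of s] sign by simp
  qed (use \<delta> in auto)
qed

text \<open>A formulation of the sweeping process with drift \<open>G\<close> that refers to values and integrals only, and
  therefore passes to uniform limits.  The last two clauses say that the upper bound can only push \<open>u\<close>
  down and the lower bound can only push it up.\<close>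

definition reflected_motion :: "real \<Rightarrow> (real \<Rightarrow> 'a) \<Rightarrow> (real \<Rightarrow> 'a) \<Rightarrow> bool" where
  "reflected_motion T G \<xi> \<longleftrightarrow>
     continuous_on {0..T} \<xi> \<and> G integrable_on {0..T} \<and>
     (\<forall>t\<in>{0..T}. \<xi> t \<in> states) \<and>
     (\<forall>t\<in>{0..T}. off_axis (\<xi> t - \<xi> 0 - integral {0..t} G) = 0) \<and>
     (\<forall>r s. 0 \<le> r \<longrightarrow> r \<le> s \<longrightarrow> s \<le> T \<longrightarrow> (\<forall>x\<in>{r..s}. lower (q \<bullet> \<xi> x) < a \<bullet> \<xi> x) \<longrightarrow>
        a \<bullet> \<xi> s - a \<bullet> \<xi> r \<le> a \<bullet> integral {0..s} G - a \<bullet> integral {0..r} G) \<and>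
     (\<forall>r s. 0 \<le> r \<longrightarrow> r \<le> s \<longrightarrow> s \<le> T \<longrightarrow> (\<forall>x\<in>{r..s}. a \<bullet> \<xi> x < upper (q \<bullet> \<xi> x)) \<longrightarrow>
        a \<bullet> integral {0..s} G - a \<bullet> integral {0..r} G \<le> a \<bullet> \<xi> s - a \<bullet> \<xi> r)"

lemma upper_locally_linear:
  assumes "e \<noteq> 0" shows "\<exists>k. \<forall>\<^sub>F x in nhds e. upper x = k * x"
proof (cases "e > 0")
  case True
  then have "\<forall>\<^sub>F x in nhds e. x \<in> {0<..}" by (intro eventually_nhds_in_open) auto
  then have "\<forall>\<^sub>F x in nhds e. upper x = k2 * x"
    by eventually_elim (use k_less in \<open>auto simp: upper_def max_def\<close>)
  then show ?thesis by blast
next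
  case False
  then have "\<forall>\<^sub>F x in nhds e. x \<in> {..<0}" using assms by (intro eventually_nhds_in_open) auto
  then have "\<forall>\<^sub>F x in nhds e. upper x = k1 * x"
    by eventually_elim (use k_less in \<open>auto simp: upper_def max_def mult_le_cancel_right\<close>)
  then show ?thesis by blast
qed

lemma lower_locally_linear:
  assumes "e \<noteq> 0" shows "\<exists>k. \<forall>\<^sub>F x in nhds e. lower x = k * x"
proof -
  obtain k where "\<forall>\<^sub>F x in nhds e. upper x = k * x" using upper_locally_linear[OF assms] by blast
  then have "\<forall>\<^sub>F x in nhds e. lower x = (k1 + k2 - k) * x"
  proof eventually_elim
    case (elim x)
    moreover have "lower x + upper x = (k1 + k2) * x" 
      unfolding lower_def upper_def by (simp add: min_def max_def algebra_simps)
    ultimately show ?case by (simp add: algebra_simps)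
  qed
  then show ?thesis by blast
qed

text \<open>On an edge away from the corner, \<open>u\<close> moves along with the edge.  The contact lemma also yields that
  the drift points out of the sector or along the edge, and tangent vectors point to the inner side
  of the edge; so the two factors in the obtuse-angle condition have the same sign.\<close>

lemma trajectory_derivative_at_constraint:
  fixes k \<sigma> :: real
  assumes \<xi>: "\<And>s. 0 \<le> s \<Longrightarrow> s \<le> T \<Longrightarrow> \<xi> s \<in> states"
    and I: "strong_derivative I v t" and t: "0 < t" "t < T"
    and off: "\<And>s. 0 \<le> s \<Longrightarrow> s \<le> T \<Longrightarrow> off_axis (\<xi> s - \<xi> 0 - I s) = 0"
    and q\<xi>: "\<And>s. 0 \<le> s \<Longrightarrow> s \<le> T \<Longrightarrow> q \<bullet> \<xi> s = q \<bullet> \<xi> 0 + q \<bullet> I s"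
    and cont: "continuous_on {0..T} \<xi>" "continuous_on {0..T} I"
    and sign: "\<sigma> * \<sigma> = 1"
    and constraint: "\<forall>\<^sub>F \<eta> in nhds (\<xi> t). \<eta> \<in> states \<longrightarrow> 0 \<le> \<sigma> * (k * (q \<bullet> \<eta>) - a \<bullet> \<eta>)"
    and zero: "a \<bullet> \<xi> t = k * (q \<bullet> \<xi> t)"
    and \<delta>: "\<delta> > 0" "\<delta> \<le> t" "\<delta> \<le> T - t"
    and push: "\<And>r s. t - \<delta> < r \<Longrightarrow> r \<le> s \<Longrightarrow> s < t + \<delta> \<Longrightarrow>
        \<sigma> * (a \<bullet> \<xi> s - a \<bullet> \<xi> r) \<le> \<sigma> * (a \<bullet> I s - a \<bullet> I r)"
    and free: "\<And>r s. t - \<delta> < r \<Longrightarrow> r \<le> s \<Longrightarrow> s < t + \<delta> \<Longrightarrow>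
        (\<And>x. r \<le> x \<Longrightarrow> x \<le> s \<Longrightarrow> 0 < \<sigma> * (k * (q \<bullet> \<xi> x) - a \<bullet> \<xi> x)) \<Longrightarrow>
        \<sigma> * (a \<bullet> I s - a \<bullet> I r) \<le> \<sigma> * (a \<bullet> \<xi> s - a \<bullet> \<xi> r)"
    and acc: "\<And>\<eta>. \<eta> > 0 \<Longrightarrow> \<exists>r. t - \<eta> < r \<and> r < t \<and> a \<bullet> \<xi> r = k * (q \<bullet> \<xi> r)"
  shows "(\<xi> has_vector_derivative ext_proj states E (\<xi> t) v) (at t)"
proof -
  have iso: "isCont \<xi> t"
    using cont(1) t by (intro continuous_on_interior) auto
  have "\<forall>\<^sub>F s in nhds t. \<xi> s \<in> states \<longrightarrow> 0 \<le> \<sigma> * (k * (q \<bullet> \<xi> s) - a \<bullet> \<xi> s)"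
    by (rule isCont_eventually_nhds[OF iso constraint])
  then obtain \<delta>' where \<delta>': "\<delta>' > 0"
    "\<And>s. t - \<delta>' < s \<Longrightarrow> s < t + \<delta>' \<Longrightarrow> \<xi> s \<in> states \<longrightarrow> 0 \<le> \<sigma> * (k * (q \<bullet> \<xi> s) - a \<bullet> \<xi> s)"
    using eventually_nhds_real_interval by blast
  define d where "d = min \<delta> \<delta>'"
  have d: "d > 0" "d \<le> \<delta>" "d \<le> \<delta>'" using \<delta> \<delta>' by (auto simp: d_def)
  have sub: "{t - d<..<t + d} \<subseteq> {0..T}" using d \<delta> by auto
  have free': "\<sigma> * (a \<bullet> I s - a \<bullet> I r) \<le> \<sigma> * (a \<bullet> \<xi> s - a \<bullet> \<xi> r)"
    if rs: "t - d < r" "r < s" "s < t + d"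
      and pos: "\<And>x. r < x \<Longrightarrow> x < s \<Longrightarrow> 0 < \<sigma> * (k * (q \<bullet> \<xi> x) - a \<bullet> \<xi> x)" for r s
  proof -
    have sub': "{r..s} \<subseteq> {0..T}" using rs d \<delta> by auto
    have "\<sigma> * (a \<bullet> I s) - \<sigma> * (a \<bullet> I r) \<le> \<sigma> * (a \<bullet> \<xi> s) - \<sigma> * (a \<bullet> \<xi> r)"
    proof (rule increment_le_open_interval[OF rs(2)])
      show "continuous_on {r..s} (\<lambda>s. \<sigma> * (a \<bullet> I s))" "continuous_on {r..s} (\<lambda>s. \<sigma> * (a \<bullet> \<xi> s))"
        by (intro continuous_intros continuous_on_subset[OF cont(1) sub'] continuous_on_subset[OF cont(2) sub'])+
      fix r' s' assume r's': "r < r'" "r' \<le> s'" "s' < s"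
      show "\<sigma> * (a \<bullet> I s') - \<sigma> * (a \<bullet> I r') \<le> \<sigma> * (a \<bullet> \<xi> s') - \<sigma> * (a \<bullet> \<xi> r')"
        using free[of r' s'] pos r's' rs d by (auto simp: algebra_simps)
    qed
    then show ?thesis by (simp add: algebra_simps)
  qed
  have nonneg': "0 \<le> \<sigma> * (k * (q \<bullet> \<xi> s) - a \<bullet> \<xi> s)" if "t - d < s" "s < t + d" for s
    using \<delta>'(2)[of s] that d \<delta> \<xi>[of s] by auto
  have q\<xi>': "q \<bullet> \<xi> s = q \<bullet> \<xi> 0 + q \<bullet> I s" if "t - d < s" "s < t + d" for s
    using q\<xi>[of s] that d \<delta> by auto
  have push': "\<sigma> * (a \<bullet> \<xi> s - a \<bullet> \<xi> r) \<le> \<sigma> * (a \<bullet> I s - a \<bullet> I r)"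
    if "t - d < r" "r \<le> s" "s < t + d" for r s
    using push[of r s] that d by auto
  note der = derivative_at_constraint[OF I d(1) continuous_on_subset[OF cont(1) sub] q\<xi>' sign nonneg' zero push' free' acc]
  have c: "\<sigma> * (k * (q \<bullet> v) - a \<bullet> v) \<le> 0"
    and u: "((\<lambda>s. a \<bullet> \<xi> s) has_vector_derivative k * (q \<bullet> v)) (at t)"
    using der by blast+
  show ?thesis
  proof (rule derivative_of_trajectory[OF \<xi> I t off u])
    fix w assume w: "w \<in> tangent_cone states (\<xi> t)" "q \<bullet> w = q \<bullet> v"
    define p where "p = \<sigma> *\<^sub>R (a - k *\<^sub>R q)"
    have p: "p \<bullet> y = - (\<sigma> * (k * (q \<bullet> y) - a \<bullet> y))" for y
      by (simp add: p_def inner_diff_left algebra_simps)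
    have "p \<bullet> w \<le> 0"
      by (rule tangent_cone_support[OF w(1)]) (use constraint zero in \<open>simp add: p\<close>)
    then have "0 \<le> \<sigma> * (k * (q \<bullet> v) - a \<bullet> w)" using w(2) by (simp add: p)
    moreover have "0 \<le> - (\<sigma> * (k * (q \<bullet> v) - a \<bullet> v))" using c by simp
    ultimately have "0 \<le> (\<sigma> * (k * (q \<bullet> v) - a \<bullet> w)) * - (\<sigma> * (k * (q \<bullet> v) - a \<bullet> v))"
      by (rule mult_nonneg_nonneg)
    also have "\<dots> = (\<sigma> * \<sigma>) * ((a \<bullet> w - k * (q \<bullet> v)) * (k * (q \<bullet> v) - a \<bullet> v))"
      by (simp add: algebra_simps)
    finally show "0 \<le> (a \<bullet> w - k * (q \<bullet> v)) * (k * (q \<bullet> v) - a \<bullet> v)" using sign by simp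
  qed auto
qed

lemma off_axis_zero_imp_q:
  assumes "off_axis y = 0" shows "q \<bullet> y = 0"
proof -
  have "y = (a \<bullet> y) *\<^sub>R a" using assms by (simp add: off_axis_def)
  from arg_cong[OF this, of "inner q"] show ?thesis by (simp add: q_inner_a)
qed

text \<open>Earlier zeros of \<open>e\<close> accumulating at \<open>t\<close> force \<open>e'(t) = 0\<close>, and \<open>\<bar>u\<bar> \<le> slope_bound * \<bar>e\<bar>\<close> then forces
  \<open>u'(t) = 0\<close>.  A tangent vector at the corner that agrees with the field in \<open>e\<close> has \<open>e\<close>-component
  \<open>0\<close>, hence \<open>u\<close>-component \<open>0\<close>, so there is no competitor with another \<open>u\<close>-component.\<close>

lemma trajectory_derivative_at_corner:
  assumes \<xi>: "\<And>s. 0 \<le> s \<Longrightarrow> s \<le> T \<Longrightarrow> \<xi> s \<in> states"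
    and I: "strong_derivative I v t" and t: "0 < t" "t < T"
    and off: "\<And>s. 0 \<le> s \<Longrightarrow> s \<le> T \<Longrightarrow> off_axis (\<xi> s - \<xi> 0 - I s) = 0"
    and q\<xi>: "\<And>s. 0 \<le> s \<Longrightarrow> s \<le> T \<Longrightarrow> q \<bullet> \<xi> s = q \<bullet> \<xi> 0 + q \<bullet> I s"
    and corner: "q \<bullet> \<xi> t = 0"
    and acc: "\<And>\<eta>. \<eta> > 0 \<Longrightarrow> \<exists>r. 0 \<le> r \<and> t - \<eta> < r \<and> r < t \<and> q \<bullet> \<xi> r = 0"
  shows "(\<xi> has_vector_derivative ext_proj states E (\<xi> t) v) (at t)"
proof -
  have u: "\<bar>a \<bullet> \<xi> s\<bar> \<le> slope_bound * \<bar>q \<bullet> \<xi> s\<bar>" if "0 \<le> s" "s \<le> T" for s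
    using \<xi>[OF that] unfolding states_iff by (intro abs_le_slope_bound) auto
  have ut: "a \<bullet> \<xi> t = 0" using u[of t] t corner by simp
  have "((\<lambda>s. q \<bullet> I s) has_vector_derivative q \<bullet> v) (at t)"
    by (intro bounded_linear.has_vector_derivative[OF bounded_linear_inner_right]
        strong_derivative_imp_has_vector_derivative I)
  then have *: "\<exists>d>0. \<forall>y. norm (y - t) < d \<longrightarrow>
      norm (q \<bullet> I y - q \<bullet> I t - (y - t) *\<^sub>R (q \<bullet> v)) \<le> \<epsilon> * norm (y - t)" if "\<epsilon> > 0" for \<epsilon>
    using that unfolding has_vector_derivative_def has_derivative_at_alt by blast
  have e: "q \<bullet> I s - q \<bullet> I t = q \<bullet> \<xi> s" if "0 \<le> s" "s \<le> T" for s
    using q\<xi>[of s] q\<xi>[of t] that corner t by simp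
  have qv: "q \<bullet> v = 0"
  proof (rule ccontr)
    assume nz: "q \<bullet> v \<noteq> 0"
    obtain d where d: "d > 0" "\<And>y. norm (y - t) < d \<Longrightarrow>
        norm (q \<bullet> I y - q \<bullet> I t - (y - t) *\<^sub>R (q \<bullet> v)) \<le> \<bar>q \<bullet> v\<bar> / 2 * norm (y - t)"
      using *[of "\<bar>q \<bullet> v\<bar> / 2"] nz by auto
    obtain r where r: "0 \<le> r" "t - d < r" "r < t" "q \<bullet> \<xi> r = 0" using acc[OF d(1)] by blast
    have "norm (q \<bullet> I r - q \<bullet> I t - (r - t) *\<^sub>R (q \<bullet> v)) \<le> \<bar>q \<bullet> v\<bar> / 2 * norm (r - t)"
      using r by (intro d) auto
    then have "\<bar>r - t\<bar> * \<bar>q \<bullet> v\<bar> \<le> \<bar>q \<bullet> v\<bar> / 2 * \<bar>r - t\<bar>"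
      using e[of r] r t by (simp add: abs_mult)
    then show False using nz r by (simp add: field_simps)
  qed
  have du: "((\<lambda>s. a \<bullet> \<xi> s) has_vector_derivative 0) (at t)"
    unfolding has_vector_derivative_def has_derivative_at_alt
  proof (intro conjI allI impI)
    show "bounded_linear (\<lambda>x. x *\<^sub>R (0::real))" by (rule bounded_linear_scaleR_left)
    fix \<epsilon> :: real assume \<epsilon>: "0 < \<epsilon>"
    define \<epsilon>' where "\<epsilon>' = \<epsilon> / (slope_bound + 1)"
    have \<epsilon>': "\<epsilon>' > 0" "slope_bound * \<epsilon>' \<le> \<epsilon>"
      using \<epsilon> slope_bound_nonneg by (auto simp: \<epsilon>'_def field_simps)
    obtain d where d: "d > 0" "\<And>y. norm (y - t) < d \<Longrightarrow>
        norm (q \<bullet> I y - q \<bullet> I t - (y - t) *\<^sub>R (q \<bullet> v)) \<le> \<epsilon>' * norm (y - t)"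
      using *[OF \<epsilon>'(1)] by blast
    have "norm (a \<bullet> \<xi> y - a \<bullet> \<xi> t - (y - t) *\<^sub>R 0) \<le> \<epsilon> * norm (y - t)"
      if y: "norm (y - t) < min d (min t (T - t))" for y
    proof -
      have yT: "0 \<le> y" "y \<le> T" using y by (auto simp: abs_less_iff)
      have "\<bar>a \<bullet> \<xi> y\<bar> \<le> slope_bound * \<bar>q \<bullet> \<xi> y\<bar>" by (rule u[OF yT])
      also have "\<dots> \<le> slope_bound * (\<epsilon>' * \<bar>y - t\<bar>)"
        using d(2)[of y] y e[OF yT] qv slope_bound_nonneg by (intro mult_left_mono) auto
      also have "\<dots> \<le> \<epsilon> * \<bar>y - t\<bar>"
        using mult_right_mono[OF \<epsilon>'(2), of "\<bar>y - t\<bar>"] by (simp add: mult.assoc)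
      finally show ?thesis using ut by simp
    qed
    then show "\<exists>d>0. \<forall>y. norm (y - t) < d \<longrightarrow> norm (a \<bullet> \<xi> y - a \<bullet> \<xi> t - (y - t) *\<^sub>R 0) \<le> \<epsilon> * norm (y - t)"
      using d t by (intro exI[of _ "min d (min t (T - t))"]) auto
  qed
  show ?thesis
  proof (rule derivative_of_trajectory[OF \<xi> I t off du])
    fix w assume w: "w \<in> tangent_cone states (\<xi> t)" "q \<bullet> w = q \<bullet> v"
    have "w \<in> states" by (rule tangent_cone_corner[OF w(1) corner ut])
    then have "a \<bullet> w = 0" using w(2) qv unfolding states_iff by (simp add: lower_def upper_def)
    then show "0 \<le> (a \<bullet> w - 0) * (0 - a \<bullet> v)" by simp
  qed auto
qed

text \<open>Besides the discontinuities of the drift, the exceptional times are the left-isolated points of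
  three closed sets: the times with \<open>e = 0\<close>, and the times of contact with either bound.\<close>

theorem reflected_motion_derivative:
  assumes "reflected_motion T G \<xi>" and X: "countable X"
    and G: "\<And>t. 0 < t \<Longrightarrow> t < T \<Longrightarrow> t \<notin> X \<Longrightarrow> isCont G t"
  shows "\<exists>N. countable N \<and> (\<forall>t. 0 < t \<longrightarrow> t < T \<longrightarrow> t \<notin> N \<longrightarrow>
    (\<xi> has_vector_derivative ext_proj states E (\<xi> t) (G t)) (at t))"
proof -
  define I where "I s = integral {0..s} G" for s
  have cont\<xi>: "continuous_on {0..T} \<xi>" and Gint: "G integrable_on {0..T}"
    and \<xi>: "\<And>t. 0 \<le> t \<Longrightarrow> t \<le> T \<Longrightarrow> \<xi> t \<in> states"
    and off: "\<And>t. 0 \<le> t \<Longrightarrow> t \<le> T \<Longrightarrow> off_axis (\<xi> t - \<xi> 0 - I t) = 0"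
    and below: "\<And>r s. 0 \<le> r \<Longrightarrow> r \<le> s \<Longrightarrow> s \<le> T \<Longrightarrow> (\<And>x. r \<le> x \<Longrightarrow> x \<le> s \<Longrightarrow> lower (q \<bullet> \<xi> x) < a \<bullet> \<xi> x) \<Longrightarrow>
      a \<bullet> \<xi> s - a \<bullet> \<xi> r \<le> a \<bullet> I s - a \<bullet> I r"
    and above: "\<And>r s. 0 \<le> r \<Longrightarrow> r \<le> s \<Longrightarrow> s \<le> T \<Longrightarrow> (\<And>x. r \<le> x \<Longrightarrow> x \<le> s \<Longrightarrow> a \<bullet> \<xi> x < upper (q \<bullet> \<xi> x)) \<Longrightarrow>
      a \<bullet> I s - a \<bullet> I r \<le> a \<bullet> \<xi> s - a \<bullet> \<xi> r"
    using assms(1) unfolding reflected_motion_def I_def by auto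
  have contI: "continuous_on {0..T} I" unfolding I_def by (rule indefinite_integral_continuous_1[OF Gint])
  have q\<xi>: "q \<bullet> \<xi> s = q \<bullet> \<xi> 0 + q \<bullet> I s" if "0 \<le> s" "s \<le> T" for s
    using off_axis_zero_imp_q[OF off[OF that]] by (simp add: inner_diff_right)
  define isolated where "isolated Z = {t \<in> Z. \<exists>\<delta>>0. Z \<inter> {t - \<delta><..<t} = {}}" for Z :: "real set"
  define Z where "Z b = {t \<in> {0..T}. a \<bullet> \<xi> t = b (q \<bullet> \<xi> t)}" for b :: "real \<Rightarrow> real"
  define Ze where "Ze = {t \<in> {0..T}. q \<bullet> \<xi> t = 0}"
  define N where "N = X \<union> isolated Ze \<union> isolated (Z upper) \<union> isolated (Z lower)"
  have acc: "\<exists>r\<in>A. t - \<eta> < r \<and> r < t" if "t \<in> A" "t \<notin> isolated A" "\<eta> > 0" for t A \<eta>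
  proof -
    have "A \<inter> {t - \<eta><..<t} \<noteq> {}" using that unfolding isolated_def by blast
    then show ?thesis by auto
  qed
  have "countable N"
    unfolding N_def isolated_def by (intro countable_Un X countable_left_isolated)
  moreover have "(\<xi> has_vector_derivative ext_proj states E (\<xi> t) (G t)) (at t)"
    if t: "0 < t" "t < T" "t \<notin> N" for t
  proof -
    have Id: "strong_derivative I (G t) t"
      unfolding I_def using t by (intro strong_derivative_integral[OF Gint] G) (auto simp: N_def)
    have iso: "isCont \<xi> t" using cont\<xi> t by (intro continuous_on_interior) auto
    have isoq: "isCont (\<lambda>s. q \<bullet> \<xi> s) t" and isoa: "isCont (\<lambda>s. a \<bullet> \<xi> s) t"
      by (intro continuous_intros iso)+
    have low: "\<forall>\<^sub>F s in nhds t. lower (q \<bullet> \<xi> s) < a \<bullet> \<xi> s" if "lower (q \<bullet> \<xi> t) < a \<bullet> \<xi> t"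
      by (rule isCont_less_eventually_nhds[OF isCont_lower[OF isoq] isoa that])
    have upp: "\<forall>\<^sub>F s in nhds t. a \<bullet> \<xi> s < upper (q \<bullet> \<xi> s)" if "a \<bullet> \<xi> t < upper (q \<bullet> \<xi> t)"
      by (rule isCont_less_eventually_nhds[OF isoa isCont_upper[OF isoq] that])
    have range: "\<forall>\<^sub>F s in nhds t. s \<in> {0<..<T}" using t by (intro eventually_nhds_in_open) auto
    consider "q \<bullet> \<xi> t = 0" | "lower (q \<bullet> \<xi> t) < a \<bullet> \<xi> t" "a \<bullet> \<xi> t < upper (q \<bullet> \<xi> t)"
      | "q \<bullet> \<xi> t \<noteq> 0" "a \<bullet> \<xi> t = upper (q \<bullet> \<xi> t)" | "q \<bullet> \<xi> t \<noteq> 0" "a \<bullet> \<xi> t = lower (q \<bullet> \<xi> t)"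
      using \<xi>[of t] t unfolding states_iff by fastforce
    then show ?thesis
    proof cases
      case 1
      have "\<exists>r. 0 \<le> r \<and> t - \<eta> < r \<and> r < t \<and> q \<bullet> \<xi> r = 0" if "\<eta> > 0" for \<eta>
        using acc[of t Ze \<eta>] t 1 that by (auto simp: Ze_def N_def)
      from trajectory_derivative_at_corner[OF \<xi> Id t(1,2) off q\<xi> 1 this] show ?thesis by simp
    next
      case 2
      have "\<forall>\<^sub>F s in nhds t. s \<in> {0<..<T} \<and> lower (q \<bullet> \<xi> s) < a \<bullet> \<xi> s \<and> a \<bullet> \<xi> s < upper (q \<bullet> \<xi> s)"
        by (intro eventually_conj range low upp 2)
      then obtain \<delta> where \<delta>: "\<delta> > 0" "\<And>s. t - \<delta> < s \<Longrightarrow> s < t + \<delta> \<Longrightarrow>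
          s \<in> {0<..<T} \<and> lower (q \<bullet> \<xi> s) < a \<bullet> \<xi> s \<and> a \<bullet> \<xi> s < upper (q \<bullet> \<xi> s)"
        by (rule eventually_nhds_real_interval) blast
      have inc: "a \<bullet> \<xi> s - a \<bullet> \<xi> r = a \<bullet> I s - a \<bullet> I r" if "t - \<delta> < r" "r \<le> s" "s < t + \<delta>" for r s
      proof (rule antisym)
        have "0 \<le> r" "s \<le> T" using \<delta>(2)[of r] \<delta>(2)[of s] that by auto
        then show "a \<bullet> \<xi> s - a \<bullet> \<xi> r \<le> a \<bullet> I s - a \<bullet> I r" "a \<bullet> I s - a \<bullet> I r \<le> a \<bullet> \<xi> s - a \<bullet> \<xi> r"
          using \<delta>(2) that by (intro below above; simp)+
      qed
      have aI: "((\<lambda>s. a \<bullet> I s) has_vector_derivative a \<bullet> G t) (at t)"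
        by (intro bounded_linear.has_vector_derivative[OF bounded_linear_inner_right]
            strong_derivative_imp_has_vector_derivative Id)
      have "((\<lambda>s. (a \<bullet> I s) + (a \<bullet> \<xi> t - a \<bullet> I t)) has_vector_derivative a \<bullet> G t + 0) (at t)"
        by (intro has_vector_derivative_add aI has_vector_derivative_const)
      then have "((\<lambda>s. a \<bullet> \<xi> s) has_vector_derivative a \<bullet> G t + 0) (at t)"
      proof (rule has_vector_derivative_transform_within_open[of _ _ t "{t - \<delta><..<t + \<delta>}"])
        fix s assume s: "s \<in> {t - \<delta><..<t + \<delta>}"
        show "(a \<bullet> I s) + (a \<bullet> \<xi> t - a \<bullet> I t) = a \<bullet> \<xi> s"
          using inc[of s t] inc[of t s] s \<delta>(1) by (cases "s \<le> t") auto
      qed (use \<delta> in auto)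
      then show ?thesis
        by (intro derivative_of_trajectory[OF \<xi> Id t(1,2) off]) auto
    next
      case 3
      obtain k where k: "\<forall>\<^sub>F x in nhds (q \<bullet> \<xi> t). upper x = k * x"
        using upper_locally_linear[OF 3(1)] by blast
      have "lower (q \<bullet> \<xi> t) < a \<bullet> \<xi> t" using lower_less_upper[OF 3(1)] 3(2) by simp
      then have "\<forall>\<^sub>F s in nhds t. s \<in> {0<..<T} \<and> lower (q \<bullet> \<xi> s) < a \<bullet> \<xi> s \<and> upper (q \<bullet> \<xi> s) = k * (q \<bullet> \<xi> s)"
        by (intro eventually_conj range low isCont_eventually_nhds[OF isoq k])
      then obtain \<delta>0 where \<delta>0: "\<delta>0 > 0" "\<And>s. t - \<delta>0 < s \<Longrightarrow> s < t + \<delta>0 \<Longrightarrow>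
          s \<in> {0<..<T} \<and> lower (q \<bullet> \<xi> s) < a \<bullet> \<xi> s \<and> upper (q \<bullet> \<xi> s) = k * (q \<bullet> \<xi> s)"
        by (rule eventually_nhds_real_interval) blast
      define \<delta> where "\<delta> = min \<delta>0 (min t (T - t))"
      have \<delta>: "\<delta> > 0" "\<delta> \<le> t" "\<delta> \<le> T - t" using \<delta>0(1) t by (auto simp: \<delta>_def)
      have near: "0 \<le> s \<and> s \<le> T \<and> lower (q \<bullet> \<xi> s) < a \<bullet> \<xi> s \<and> upper (q \<bullet> \<xi> s) = k * (q \<bullet> \<xi> s)"
        if "t - \<delta> < s" "s < t + \<delta>" for s
      proof -
        have "t - \<delta>0 < s" "s < t + \<delta>0" using that by (auto simp: \<delta>_def)
        then show ?thesis using \<delta>0(2)[of s] by auto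
      qed
      show ?thesis
      proof (rule trajectory_derivative_at_constraint[OF \<xi> Id t(1,2) off q\<xi> cont\<xi> contI, of 1 k \<delta>])
        have "\<forall>\<^sub>F \<eta> in nhds (\<xi> t). upper (q \<bullet> \<eta>) = k * (q \<bullet> \<eta>)"
          by (rule isCont_eventually_nhds[where f = "\<lambda>\<eta>. q \<bullet> \<eta>", OF _ k]) (intro continuous_intros)
        then show "\<forall>\<^sub>F \<eta> in nhds (\<xi> t). \<eta> \<in> states \<longrightarrow> 0 \<le> 1 * (k * (q \<bullet> \<eta>) - a \<bullet> \<eta>)"
          by eventually_elim (simp add: states_iff)
        show "a \<bullet> \<xi> t = k * (q \<bullet> \<xi> t)" using near[of t] \<delta>(1) 3(2) by simp
        show "1 * (a \<bullet> \<xi> s - a \<bullet> \<xi> r) \<le> 1 * (a \<bullet> I s - a \<bullet> I r)"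
          if "t - \<delta> < r" "r \<le> s" "s < t + \<delta>" for r s
          unfolding mult_1 by (rule below) (use near that in auto)
        show "1 * (a \<bullet> I s - a \<bullet> I r) \<le> 1 * (a \<bullet> \<xi> s - a \<bullet> \<xi> r)"
          if rs: "t - \<delta> < r" "r \<le> s" "s < t + \<delta>"
            and pos: "\<And>x. r \<le> x \<Longrightarrow> x \<le> s \<Longrightarrow> 0 < 1 * (k * (q \<bullet> \<xi> x) - a \<bullet> \<xi> x)" for r s
          unfolding mult_1
        proof (rule above)
          show "a \<bullet> \<xi> x < upper (q \<bullet> \<xi> x)" if "r \<le> x" "x \<le> s" for x
            using pos[OF that] near[of x] that rs by simp
        qed (use near rs in auto)
        show "\<exists>r. t - \<eta> < r \<and> r < t \<and> a \<bullet> \<xi> r = k * (q \<bullet> \<xi> r)" if \<eta>: "\<eta> > 0" for \<eta>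
        proof -
          have "t \<in> Z upper" using t 3(2) by (simp add: Z_def)
          then obtain r where r: "r \<in> Z upper" "t - min \<eta> \<delta> < r" "r < t"
            using acc[of t "Z upper" "min \<eta> \<delta>"] t(3) \<eta> \<delta>(1) unfolding N_def by auto
          then show ?thesis using near[of r] \<delta>(1) by (intro exI[of _ r]) (auto simp: Z_def)
        qed
      qed (use \<delta> in auto)
    next
      case 4
      obtain k where k: "\<forall>\<^sub>F x in nhds (q \<bullet> \<xi> t). lower x = k * x"
        using lower_locally_linear[OF 4(1)] by blast
      have "a \<bullet> \<xi> t < upper (q \<bullet> \<xi> t)" using lower_less_upper[OF 4(1)] 4(2) by simp
      then have "\<forall>\<^sub>F s in nhds t. s \<in> {0<..<T} \<and> a \<bullet> \<xi> s < upper (q \<bullet> \<xi> s) \<and> lower (q \<bullet> \<xi> s) = k * (q \<bullet> \<xi> s)"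
        by (intro eventually_conj range upp isCont_eventually_nhds[OF isoq k])
      then obtain \<delta>0 where \<delta>0: "\<delta>0 > 0" "\<And>s. t - \<delta>0 < s \<Longrightarrow> s < t + \<delta>0 \<Longrightarrow>
          s \<in> {0<..<T} \<and> a \<bullet> \<xi> s < upper (q \<bullet> \<xi> s) \<and> lower (q \<bullet> \<xi> s) = k * (q \<bullet> \<xi> s)"
        by (rule eventually_nhds_real_interval) blast
      define \<delta> where "\<delta> = min \<delta>0 (min t (T - t))"
      have \<delta>: "\<delta> > 0" "\<delta> \<le> t" "\<delta> \<le> T - t" using \<delta>0(1) t by (auto simp: \<delta>_def)
      have near: "0 \<le> s \<and> s \<le> T \<and> a \<bullet> \<xi> s < upper (q \<bullet> \<xi> s) \<and> lower (q \<bullet> \<xi> s) = k * (q \<bullet> \<xi> s)"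
        if "t - \<delta> < s" "s < t + \<delta>" for s
      proof -
        have "t - \<delta>0 < s" "s < t + \<delta>0" using that by (auto simp: \<delta>_def)
        then show ?thesis using \<delta>0(2)[of s] by auto
      qed
      show ?thesis
      proof (rule trajectory_derivative_at_constraint[OF \<xi> Id t(1,2) off q\<xi> cont\<xi> contI, of "-1" k \<delta>])
        have "\<forall>\<^sub>F \<eta> in nhds (\<xi> t). lower (q \<bullet> \<eta>) = k * (q \<bullet> \<eta>)"
          by (rule isCont_eventually_nhds[where f = "\<lambda>\<eta>. q \<bullet> \<eta>", OF _ k]) (intro continuous_intros)
        then show "\<forall>\<^sub>F \<eta> in nhds (\<xi> t). \<eta> \<in> states \<longrightarrow> 0 \<le> - 1 * (k * (q \<bullet> \<eta>) - a \<bullet> \<eta>)"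
          by eventually_elim (simp add: states_iff)
        show "a \<bullet> \<xi> t = k * (q \<bullet> \<xi> t)" using near[of t] \<delta>(1) 4(2) by simp
        show "- 1 * (a \<bullet> \<xi> s - a \<bullet> \<xi> r) \<le> - 1 * (a \<bullet> I s - a \<bullet> I r)"
          if "t - \<delta> < r" "r \<le> s" "s < t + \<delta>" for r s
        proof -
          have "a \<bullet> I s - a \<bullet> I r \<le> a \<bullet> \<xi> s - a \<bullet> \<xi> r"
            by (rule above) (use near that in auto)
          then show ?thesis by simp
        qed
        show "- 1 * (a \<bullet> I s - a \<bullet> I r) \<le> - 1 * (a \<bullet> \<xi> s - a \<bullet> \<xi> r)"
          if rs: "t - \<delta> < r" "r \<le> s" "s < t + \<delta>"
            and pos: "\<And>x. r \<le> x \<Longrightarrow> x \<le> s \<Longrightarrow> 0 < - 1 * (k * (q \<bullet> \<xi> x) - a \<bullet> \<xi> x)" for r s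
        proof -
          have "a \<bullet> \<xi> s - a \<bullet> \<xi> r \<le> a \<bullet> I s - a \<bullet> I r"
          proof (rule below)
            show "lower (q \<bullet> \<xi> x) < a \<bullet> \<xi> x" if "r \<le> x" "x \<le> s" for x
              using pos[OF that] near[of x] that rs by simp
          qed (use near rs in auto)
          then show ?thesis by simp
        qed
        show "\<exists>r. t - \<eta> < r \<and> r < t \<and> a \<bullet> \<xi> r = k * (q \<bullet> \<xi> r)" if \<eta>: "\<eta> > 0" for \<eta>
        proof -
          have "t \<in> Z lower" using t 4(2) by (simp add: Z_def)
          then obtain r where r: "r \<in> Z lower" "t - min \<eta> \<delta> < r" "r < t"
            using acc[of t "Z lower" "min \<eta> \<delta>"] t(3) \<eta> \<delta>(1) unfolding N_def by auto
          then show ?thesis using near[of r] \<delta>(1) by (intro exI[of _ r]) (auto simp: Z_def)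
        qed
      qed (use \<delta> in auto)
    qed
  qed
  ultimately show ?thesis by blast
qed

end

section \<open>The catching-up scheme\<close>

text \<open>\<open>H y s\<close> is the field at state \<open>y\<close> under the input at time \<open>s\<close>.  The scheme freezes
  \<open>y\<close> during a step and integrates over \<open>s\<close>, hence the separate conditions in the two variables.\<close>

locale bounded_sector_field = sector_system +
  fixes H :: "'a \<Rightarrow> real \<Rightarrow> 'a" and B :: real
  assumes H_integrable: "\<And>y r s. H y integrable_on {r..s}"
    and H_bound: "\<And>y s. norm (H y s) \<le> B"
    and H_continuous: "\<And>y s. isCont (\<lambda>y. H y s) y"
begin

lemma B_nonneg: "0 \<le> B"
  using H_bound[of 0 0] norm_ge_zero order_trans by blast

definition speed :: real where "speed = clip_lipschitz * B"

lemma speed_nonneg: "0 \<le> speed"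
  using clip_lipschitz_ge B_nonneg by (simp add: speed_def)

primrec euler :: "real \<Rightarrow> 'a \<Rightarrow> nat \<Rightarrow> 'a" where
  "euler h \<xi>0 0 = \<xi>0"
| "euler h \<xi>0 (Suc k) = clip (euler h \<xi>0 k + integral {real k * h..real (Suc k) * h} (H (euler h \<xi>0 k)))"

definition cell :: "real \<Rightarrow> real \<Rightarrow> nat" where "cell h s = nat \<lfloor>s / h\<rfloor>"

definition euler_velocity :: "real \<Rightarrow> 'a \<Rightarrow> real \<Rightarrow> 'a" where
  "euler_velocity h \<xi>0 s = H (euler h \<xi>0 (cell h s)) s"

text \<open>The interpolation clips at every time, not just at the grid points.  So it remains in the sector,
  and it inherits its Lipschitz constant from \<open>clip\<close>.\<close>

definition euler_path :: "real \<Rightarrow> 'a \<Rightarrow> real \<Rightarrow> 'a" where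
  "euler_path h \<xi>0 t = clip (euler h \<xi>0 (cell h t) +
     integral {real (cell h t) * h..t} (H (euler h \<xi>0 (cell h t))))"

lemma cell_eq:
  assumes "0 < h" "real k * h \<le> s" "s < real (Suc k) * h"
  shows "cell h s = k"
proof -
  have "\<lfloor>s / h\<rfloor> = int k" using assms by (intro floor_unique) (auto simp: field_simps)
  then show ?thesis by (simp add: cell_def)
qed

lemma cell_bounds:
  assumes "0 < h" "0 \<le> s"
  shows "real (cell h s) * h \<le> s" "s < real (Suc (cell h s)) * h"
proof -
  have "0 \<le> s / h" using assms by simp
  then have "real (cell h s) = of_int \<lfloor>s / h\<rfloor>" unfolding cell_def by simp
  moreover have "of_int \<lfloor>s / h\<rfloor> * h \<le> s" "s < (of_int \<lfloor>s / h\<rfloor> + 1) * h"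
    using of_int_floor_le[of "s / h"] real_of_int_floor_add_one_gt[of "s / h"]
    by (simp_all only: pos_le_divide_eq[OF assms(1)] pos_divide_less_eq[OF assms(1)])
  ultimately show "real (cell h s) * h \<le> s" "s < real (Suc (cell h s)) * h"
    by (simp_all add: algebra_simps)
qed

lemma cell_mono: "0 < h \<Longrightarrow> r \<le> s \<Longrightarrow> cell h r \<le> cell h s"
  unfolding cell_def by (intro nat_mono floor_mono divide_right_mono) auto

lemma norm_integral_H:
  assumes "r \<le> s" shows "norm (integral {r..s} (H y)) \<le> B * (s - r)"
proof -
  have "norm (integral {r..s} (H y)) \<le> integral {r..s} (\<lambda>_. B)"
    by (intro integral_norm_bound_integral H_integrable integrable_const_ivl H_bound)
  then show ?thesis using assms by (simp add: mult.commute)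
qed

context
  fixes h :: real and \<xi>0 :: 'a
  assumes h: "0 < h" and \<xi>0: "\<xi>0 \<in> states"
begin

lemma euler_in_states: "euler h \<xi>0 k \<in> states"
  by (cases k) (auto simp: \<xi>0 clip_in_states)

text \<open>At the right end point of a cell \<open>cell\<close> already returns the next index; the formula of the old
  index still holds there because clipping an admissible state has no effect.\<close>

lemma euler_path_on_cell:
  assumes "real k * h \<le> t" "t \<le> real (Suc k) * h"
  shows "euler_path h \<xi>0 t = clip (euler h \<xi>0 k + integral {real k * h..t} (H (euler h \<xi>0 k)))"
proof (cases "t = real (Suc k) * h")
  case True
  have "cell h t = Suc k" using h True by (intro cell_eq) (auto simp: algebra_simps)
  then show ?thesis using True clip_ident[OF clip_in_states] by (simp add: euler_path_def)
next
  case False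
  then have "cell h t = k" using assms h by (intro cell_eq) auto
  then show ?thesis by (simp add: euler_path_def)
qed

lemma euler_path_grid: "euler_path h \<xi>0 (real k * h) = euler h \<xi>0 k"
  using euler_path_on_cell[of k "real k * h"] h clip_ident[OF euler_in_states] by (simp add: algebra_simps)

lemma euler_path_in_states: "euler_path h \<xi>0 t \<in> states"
  by (simp add: euler_path_def clip_in_states)

lemma euler_path_lipschitz_cell: "speed-lipschitz_on {real k * h..real (Suc k) * h} (euler_path h \<xi>0)"
proof (rule lipschitz_on_leI[OF _ speed_nonneg])
  fix r s assume rs: "r \<in> {real k * h..real (Suc k) * h}" "s \<in> {real k * h..real (Suc k) * h}" "r \<le> s"
  let ?y = "euler h \<xi>0 k"
  have "integral {real k * h..s} (H ?y) = integral {real k * h..r} (H ?y) + integral {r..s} (H ?y)"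
    using Henstock_Kurzweil_Integration.integral_combine[of "real k * h" r s "H ?y"] rs H_integrable by auto
  then have "norm (euler_path h \<xi>0 s - euler_path h \<xi>0 r) \<le> clip_lipschitz * norm (integral {r..s} (H ?y))"
    using norm_clip_diff[of "?y + integral {real k * h..s} (H ?y)" "?y + integral {real k * h..r} (H ?y)"]
      euler_path_on_cell[of k s] euler_path_on_cell[of k r] rs by simp
  also have "\<dots> \<le> clip_lipschitz * (B * (s - r))"
    using norm_integral_H[OF rs(3)] clip_lipschitz_ge by (intro mult_left_mono) auto
  finally show "dist (euler_path h \<xi>0 r) (euler_path h \<xi>0 s) \<le> speed * dist r s"
    using rs(3) by (simp add: speed_def dist_norm norm_minus_commute algebra_simps)
qed

lemma euler_path_lipschitz_grid: "speed-lipschitz_on {0..real k * h} (euler_path h \<xi>0)"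
proof (induction k)
  case 0
  then show ?case using speed_nonneg by (simp add: lipschitz_on_def)
next
  case (Suc k)
  show ?case using lipschitz_on_concat[OF Suc euler_path_lipschitz_cell refl] by simp
qed

lemma euler_path_lipschitz: "speed-lipschitz_on {0..} (euler_path h \<xi>0)"
proof (rule lipschitz_on_leI[OF _ speed_nonneg])
  fix r s :: real assume rs: "r \<in> {0..}" "s \<in> {0..}" "r \<le> s"
  have "s \<le> real (Suc (cell h s)) * h" using cell_bounds(2)[OF h, of s] rs by simp
  then show "dist (euler_path h \<xi>0 r) (euler_path h \<xi>0 s) \<le> speed * dist r s"
    using rs by (intro lipschitz_onD[OF euler_path_lipschitz_grid[of "Suc (cell h s)"]]) auto
qed

lemma norm_euler_path_diff: "0 \<le> r \<Longrightarrow> r \<le> s \<Longrightarrow> norm (euler_path h \<xi>0 s - euler_path h \<xi>0 r) \<le> speed * (s - r)"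
  using lipschitz_onD[OF euler_path_lipschitz, of s r] by (simp add: dist_norm)

lemma euler_velocity_on_cell:
  assumes "real k * h \<le> t" "t \<le> real (Suc k) * h"
  shows "euler_velocity h \<xi>0 integrable_on {real k * h..t}"
    and "integral {real k * h..t} (euler_velocity h \<xi>0) = integral {real k * h..t} (H (euler h \<xi>0 k))"
proof -
  have eq: "euler_velocity h \<xi>0 s = H (euler h \<xi>0 k) s" if "s \<in> {real k * h..t} - {real (Suc k) * h}" for s
    using cell_eq[OF h, of k s] that assms by (auto simp: euler_velocity_def)
  have N: "negligible {real (Suc k) * h}" by simp
  show "euler_velocity h \<xi>0 integrable_on {real k * h..t}"
    by (rule integrable_spike[OF H_integrable N eq])
  show "integral {real k * h..t} (euler_velocity h \<xi>0) = integral {real k * h..t} (H (euler h \<xi>0 k))"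
    by (rule integral_spike[OF N]) (use eq in auto)
qed

lemma euler_velocity_integrable_grid: "euler_velocity h \<xi>0 integrable_on {0..real k * h}"
proof (induction k)
  case 0
  then show ?case using integrable_on_refl[of "euler_velocity h \<xi>0" 0] by simp
next
  case (Suc k)
  show ?case
    by (rule Henstock_Kurzweil_Integration.integrable_combine[OF _ _ Suc euler_velocity_on_cell(1)])
      (use h in \<open>auto simp: algebra_simps\<close>)
qed

lemma euler_velocity_integrable:
  assumes "0 \<le> r" shows "euler_velocity h \<xi>0 integrable_on {r..s}"
proof (cases "r \<le> s")
  case True
  have "s \<le> real (Suc (cell h s)) * h" using cell_bounds(2)[OF h, of s] assms True by simp
  then show ?thesis using assms by (intro integrable_subinterval_real[OF euler_velocity_integrable_grid[of "Suc (cell h s)"]]) auto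
qed (simp add: integrable_on_empty)

lemma euler_velocity_bound: "norm (euler_velocity h \<xi>0 s) \<le> B"
  by (simp add: euler_velocity_def H_bound)

lemma integral_euler_velocity_split:
  assumes "0 \<le> r" "r \<le> s"
  shows "integral {0..s} (euler_velocity h \<xi>0) = integral {0..r} (euler_velocity h \<xi>0) + integral {r..s} (euler_velocity h \<xi>0)"
  using Henstock_Kurzweil_Integration.integral_combine[of 0 r s "euler_velocity h \<xi>0"] assms euler_velocity_integrable
  by auto

lemma norm_integral_euler_velocity_diff:
  assumes "0 \<le> r" "r \<le> s"
  shows "norm (integral {0..s} (euler_velocity h \<xi>0) - integral {0..r} (euler_velocity h \<xi>0)) \<le> B * (s - r)"
proof -
  have "norm (integral {r..s} (euler_velocity h \<xi>0)) \<le> integral {r..s} (\<lambda>_. B)"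
    by (intro integral_norm_bound_integral euler_velocity_integrable assms integrable_const_ivl euler_velocity_bound)
  then show ?thesis using assms integral_euler_velocity_split[OF assms] by (simp add: mult.commute)
qed

lemma euler_Suc:
  "euler h \<xi>0 (Suc k) = clip (euler h \<xi>0 k +
     (integral {0..real (Suc k) * h} (euler_velocity h \<xi>0) - integral {0..real k * h} (euler_velocity h \<xi>0)))"
  using integral_euler_velocity_split[of "real k * h" "real (Suc k) * h"] euler_velocity_on_cell(2)[of k "real (Suc k) * h"] h
  by (simp add: algebra_simps)

lemma off_axis_euler: "off_axis (euler h \<xi>0 k - \<xi>0 - integral {0..real k * h} (euler_velocity h \<xi>0)) = 0"
proof (induction k)
  case 0
  then show ?case by (simp add: off_axis_def)
next
  case (Suc k)
  then show ?case unfolding euler_Suc by (simp add: off_axis_diff off_axis_clip off_axis_add algebra_simps)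
qed

lemma off_axis_euler_path:
  assumes "0 \<le> t"
  shows "off_axis (euler_path h \<xi>0 t - \<xi>0 - integral {0..t} (euler_velocity h \<xi>0)) = 0"
proof -
  define k where "k = cell h t"
  have k: "real k * h \<le> t" "t \<le> real (Suc k) * h"
    using cell_bounds[OF h assms] by (auto simp: k_def)
  have "integral {0..t} (euler_velocity h \<xi>0) =
      integral {0..real k * h} (euler_velocity h \<xi>0) + integral {real k * h..t} (H (euler h \<xi>0 k))"
    using integral_euler_velocity_split[of "real k * h" t] euler_velocity_on_cell(2)[OF k] h k by simp
  then show ?thesis using off_axis_euler[of k] euler_path_on_cell[OF k]
    by (simp add: off_axis_diff off_axis_clip off_axis_add algebra_simps)
qed

text \<open>A step that ends strictly above the lower bound was not raised by clipping.  The index \<open>i\<close> itself is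
  exempt, since only the steps ending at \<open>i + 1, \<dots>, k\<close> enter.\<close>

lemma euler_increment_le:
  assumes "i \<le> k" "\<And>j. i < j \<Longrightarrow> j \<le> k \<Longrightarrow> lower (q \<bullet> euler h \<xi>0 j) < a \<bullet> euler h \<xi>0 j"
  shows "a \<bullet> euler h \<xi>0 k - a \<bullet> euler h \<xi>0 i \<le>
    a \<bullet> integral {0..real k * h} (euler_velocity h \<xi>0) - a \<bullet> integral {0..real i * h} (euler_velocity h \<xi>0)"
  using assms
proof (induction k rule: dec_induct)
  case (step k)
  have "lower (q \<bullet> euler h \<xi>0 (Suc k)) < a \<bullet> euler h \<xi>0 (Suc k)" using step(1) by (intro step.prems) auto
  then have "a \<bullet> euler h \<xi>0 (Suc k) \<le> a \<bullet> (euler h \<xi>0 k +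
     (integral {0..real (Suc k) * h} (euler_velocity h \<xi>0) - integral {0..real k * h} (euler_velocity h \<xi>0)))"
    unfolding euler_Suc q_clip a_clip by linarith
  then show ?case using step.IH step.prems by (simp add: inner_add_right inner_diff_right del: euler.simps)
qed simp

lemma euler_increment_ge:
  assumes "i \<le> k" "\<And>j. i < j \<Longrightarrow> j \<le> k \<Longrightarrow> a \<bullet> euler h \<xi>0 j < upper (q \<bullet> euler h \<xi>0 j)"
  shows "a \<bullet> integral {0..real k * h} (euler_velocity h \<xi>0) - a \<bullet> integral {0..real i * h} (euler_velocity h \<xi>0) \<le>
    a \<bullet> euler h \<xi>0 k - a \<bullet> euler h \<xi>0 i"
  using assms
proof (induction k rule: dec_induct)
  case (step k)
  have "a \<bullet> euler h \<xi>0 (Suc k) < upper (q \<bullet> euler h \<xi>0 (Suc k))" using step(1) by (intro step.prems) auto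
  then have "a \<bullet> (euler h \<xi>0 k +
     (integral {0..real (Suc k) * h} (euler_velocity h \<xi>0) - integral {0..real k * h} (euler_velocity h \<xi>0)))
     \<le> a \<bullet> euler h \<xi>0 (Suc k)"
    unfolding euler_Suc q_clip a_clip by linarith
  then show ?case using step.IH step.prems by (simp add: inner_add_right inner_diff_right del: euler.simps)
qed simp

lemma abs_a_inner: "\<bar>a \<bullet> x\<bar> \<le> norm x"
  using Cauchy_Schwarz_ineq2[of a x] by (simp add: norm_a)

lemma grid_rounding:
  assumes "0 \<le> t"
  shows "\<bar>a \<bullet> euler_path h \<xi>0 t - a \<bullet> euler h \<xi>0 (cell h t)\<bar> \<le> speed * h"
    and "\<bar>a \<bullet> integral {0..t} (euler_velocity h \<xi>0) - a \<bullet> integral {0..real (cell h t) * h} (euler_velocity h \<xi>0)\<bar> \<le> B * h"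
proof -
  define k where "k = cell h t"
  have k: "0 \<le> real k * h" "real k * h \<le> t" "t - real k * h \<le> h"
    using cell_bounds[OF h assms] h by (auto simp: k_def algebra_simps)
  have "\<bar>a \<bullet> euler_path h \<xi>0 t - a \<bullet> euler h \<xi>0 k\<bar> \<le> norm (euler_path h \<xi>0 t - euler_path h \<xi>0 (real k * h))"
    using abs_a_inner[of "euler_path h \<xi>0 t - euler_path h \<xi>0 (real k * h)"] by (simp add: inner_diff_right euler_path_grid)
  also have "\<dots> \<le> speed * (t - real k * h)" using k by (intro norm_euler_path_diff) auto
  also have "\<dots> \<le> speed * h" using k speed_nonneg by (intro mult_left_mono) auto
  finally show "\<bar>a \<bullet> euler_path h \<xi>0 t - a \<bullet> euler h \<xi>0 (cell h t)\<bar> \<le> speed * h" by (simp add: k_def)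
  have "\<bar>a \<bullet> integral {0..t} (euler_velocity h \<xi>0) - a \<bullet> integral {0..real k * h} (euler_velocity h \<xi>0)\<bar>
      \<le> norm (integral {0..t} (euler_velocity h \<xi>0) - integral {0..real k * h} (euler_velocity h \<xi>0))"
    using abs_a_inner[of "integral {0..t} (euler_velocity h \<xi>0) - integral {0..real k * h} (euler_velocity h \<xi>0)"]
    by (simp add: inner_diff_right)
  also have "\<dots> \<le> B * (t - real k * h)" using k by (intro norm_integral_euler_velocity_diff) auto
  also have "\<dots> \<le> B * h" using k B_nonneg by (intro mult_left_mono) auto
  finally show "\<bar>a \<bullet> integral {0..t} (euler_velocity h \<xi>0) - a \<bullet> integral {0..real (cell h t) * h} (euler_velocity h \<xi>0)\<bar> \<le> B * h"
    by (simp add: k_def)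
qed

text \<open>The discrete inequalities at arbitrary times, up to the error of rounding both times down to the
  grid.  Rounding down is harmless: the grid points after the rounded \<open>r\<close> lie in \<open>[r, s]\<close>.\<close>

lemma euler_path_increment:
  assumes rs: "0 \<le> r" "r \<le> s"
  shows "(\<And>x. r \<le> x \<Longrightarrow> x \<le> s \<Longrightarrow> lower (q \<bullet> euler_path h \<xi>0 x) < a \<bullet> euler_path h \<xi>0 x) \<Longrightarrow>
      a \<bullet> euler_path h \<xi>0 s - a \<bullet> euler_path h \<xi>0 r \<le>
      a \<bullet> integral {0..s} (euler_velocity h \<xi>0) - a \<bullet> integral {0..r} (euler_velocity h \<xi>0) + 2 * (speed + B) * h"
    and "(\<And>x. r \<le> x \<Longrightarrow> x \<le> s \<Longrightarrow> a \<bullet> euler_path h \<xi>0 x < upper (q \<bullet> euler_path h \<xi>0 x)) \<Longrightarrow>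
      a \<bullet> integral {0..s} (euler_velocity h \<xi>0) - a \<bullet> integral {0..r} (euler_velocity h \<xi>0) \<le>
      a \<bullet> euler_path h \<xi>0 s - a \<bullet> euler_path h \<xi>0 r + 2 * (speed + B) * h"
proof -
  have le: "cell h r \<le> cell h s" by (rule cell_mono[OF h rs(2)])
  have grid: "r \<le> real j * h" "real j * h \<le> s" if "cell h r < j" "j \<le> cell h s" for j
  proof -
    have "real (Suc (cell h r)) * h \<le> real j * h" "real j * h \<le> real (cell h s) * h"
      using that h by (intro mult_right_mono; simp)+
    then show "r \<le> real j * h" "real j * h \<le> s"
      using cell_bounds[OF h rs(1)] cell_bounds[OF h order_trans[OF rs]] by linarith+
  qed
  have round: "\<bar>a \<bullet> euler_path h \<xi>0 r - a \<bullet> euler h \<xi>0 (cell h r)\<bar> \<le> speed * h"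
    "\<bar>a \<bullet> euler_path h \<xi>0 s - a \<bullet> euler h \<xi>0 (cell h s)\<bar> \<le> speed * h"
    "\<bar>a \<bullet> integral {0..r} (euler_velocity h \<xi>0) - a \<bullet> integral {0..real (cell h r) * h} (euler_velocity h \<xi>0)\<bar> \<le> B * h"
    "\<bar>a \<bullet> integral {0..s} (euler_velocity h \<xi>0) - a \<bullet> integral {0..real (cell h s) * h} (euler_velocity h \<xi>0)\<bar> \<le> B * h"
    using rs by (auto intro!: grid_rounding)
  have eq: "2 * (speed + B) * h = speed * h + speed * h + B * h + B * h" by (simp add: algebra_simps)
  show "a \<bullet> euler_path h \<xi>0 s - a \<bullet> euler_path h \<xi>0 r \<le>
      a \<bullet> integral {0..s} (euler_velocity h \<xi>0) - a \<bullet> integral {0..r} (euler_velocity h \<xi>0) + 2 * (speed + B) * h"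
    if *: "\<And>x. r \<le> x \<Longrightarrow> x \<le> s \<Longrightarrow> lower (q \<bullet> euler_path h \<xi>0 x) < a \<bullet> euler_path h \<xi>0 x"
  proof -
    have "lower (q \<bullet> euler h \<xi>0 j) < a \<bullet> euler h \<xi>0 j" if "cell h r < j" "j \<le> cell h s" for j
      using *[OF grid[OF that]] by (simp add: euler_path_grid)
    from euler_increment_le[OF le this] show ?thesis using round unfolding eq by linarith
  qed
  show "a \<bullet> integral {0..s} (euler_velocity h \<xi>0) - a \<bullet> integral {0..r} (euler_velocity h \<xi>0) \<le>
      a \<bullet> euler_path h \<xi>0 s - a \<bullet> euler_path h \<xi>0 r + 2 * (speed + B) * h"
    if *: "\<And>x. r \<le> x \<Longrightarrow> x \<le> s \<Longrightarrow> a \<bullet> euler_path h \<xi>0 x < upper (q \<bullet> euler_path h \<xi>0 x)"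
  proof -
    have "a \<bullet> euler h \<xi>0 j < upper (q \<bullet> euler h \<xi>0 j)" if "cell h r < j" "j \<le> cell h s" for j
      using *[OF grid[OF that]] by (simp add: euler_path_grid)
    from euler_increment_ge[OF le this] show ?thesis using round unfolding eq by linarith
  qed
qed

end

section \<open>Limits of the catching-up scheme\<close>

text \<open>The limit of a uniformly convergent subsequence of catching-up paths.  The frozen states converge
  to the limit path as well, so dominated convergence passes the integrals to the limit.  Where the
  limit keeps away from a bound on a compact time interval, so do the approximations eventually;
  hence their increment inequalities are available, with an error that vanishes with the step size.\<close>

theorem reflected_motion_exists:
  assumes \<xi>0: "\<xi>0 \<in> states" and T: "0 \<le> T"
  shows "\<exists>\<xi>. \<xi> 0 = \<xi>0 \<and> speed-lipschitz_on {0..T} \<xi> \<and> reflected_motion T (\<lambda>s. H (\<xi> s) s) \<xi>"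
proof -
  define h0 where "h0 n = inverse (real (Suc n))" for n
  have h0: "0 < h0 n" for n by (simp add: h0_def)
  have bnd: "norm (euler_path (h0 n) \<xi>0 x) \<le> norm \<xi>0 + speed * T" if "x \<in> {0..T}" for n x
  proof -
    have "norm (euler_path (h0 n) \<xi>0 x - euler_path (h0 n) \<xi>0 0) \<le> speed * (x - 0)"
      using that by (intro norm_euler_path_diff[OF h0 \<xi>0]) auto
    also have "\<dots> \<le> speed * T" using that speed_nonneg by (intro mult_left_mono) auto
    finally show ?thesis using euler_path_grid[OF h0 \<xi>0, of n 0] norm_triangle_sub[of "euler_path (h0 n) \<xi>0 x" \<xi>0] by simp
  qed
  have equi: "\<exists>d>0. \<forall>n y. y \<in> {0..T} \<and> norm (x - y) < d \<longrightarrow> norm (euler_path (h0 n) \<xi>0 x - euler_path (h0 n) \<xi>0 y) < e"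
    if x: "x \<in> {0..T}" and "0 < e" for x e
  proof (rule exI[of _ "e / (speed + 1)"], intro conjI allI impI)
    show "0 < e / (speed + 1)" using \<open>0 < e\<close> speed_nonneg by simp
    fix n y assume y: "y \<in> {0..T} \<and> norm (x - y) < e / (speed + 1)"
    have "norm (euler_path (h0 n) \<xi>0 x - euler_path (h0 n) \<xi>0 y) \<le> speed * \<bar>x - y\<bar>"
      using lipschitz_onD[OF euler_path_lipschitz[OF h0 \<xi>0], of x y n] x y by (simp add: dist_norm)
    also have "\<dots> \<le> (speed + 1) * \<bar>x - y\<bar>" by (intro mult_right_mono) auto
    also have "\<dots> < e" using y speed_nonneg by (simp add: field_simps)
    finally show "norm (euler_path (h0 n) \<xi>0 x - euler_path (h0 n) \<xi>0 y) < e" .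
  qed
  obtain \<xi> \<kappa> where cont: "continuous_on {0..T} \<xi>" and \<kappa>: "strict_mono (\<kappa> :: nat \<Rightarrow> nat)"
    and uc: "\<And>e. 0 < e \<Longrightarrow> \<exists>N. \<forall>n x. n \<ge> N \<and> x \<in> {0..T} \<longrightarrow> norm (euler_path (h0 (\<kappa> n)) \<xi>0 x - \<xi> x) < e"
    using Arzela_Ascoli[of "{0..T}" "\<lambda>n. euler_path (h0 n) \<xi>0" "norm \<xi>0 + speed * T"] bnd equi compact_Icc
    by metis
  define h where "h n = h0 (\<kappa> n)" for n
  have h: "0 < h n" for n by (simp add: h_def h0)
  have "h = (\<lambda>n. inverse (real (Suc n))) \<circ> \<kappa>" by (simp add: fun_eq_iff h_def h0_def)
  then have hlim: "h \<longlonglongrightarrow> 0"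
    using LIMSEQ_subseq_LIMSEQ[OF LIMSEQ_inverse_real_of_nat \<kappa>] by simp
  define P where "P n = euler_path (h n) \<xi>0" for n
  define V where "V n = euler_velocity (h n) \<xi>0" for n
  define G where "G s = H (\<xi> s) s" for s
  have uc: "\<exists>N. \<forall>n x. n \<ge> N \<and> x \<in> {0..T} \<longrightarrow> norm (P n x - \<xi> x) < e" if "0 < e" for e
    using uc[OF that] by (simp add: P_def h_def)
  have Plim: "(\<lambda>n. P n x) \<longlonglongrightarrow> \<xi> x" if "x \<in> {0..T}" for x
    unfolding LIMSEQ_iff using uc that by meson
  have \<xi>_states: "\<xi> t \<in> states" if "t \<in> {0..T}" for t
    by (rule closed_sequentially[OF closed_states _ Plim[OF that]]) (simp add: P_def euler_path_in_states[OF h \<xi>0])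
  have \<xi>_0: "\<xi> 0 = \<xi>0"
  proof -
    have "P n 0 = \<xi>0" for n using euler_path_grid[OF h \<xi>0, of n 0] by (simp add: P_def)
    then show ?thesis using Plim[of 0] T by (simp add: LIMSEQ_const_iff)
  qed
  have lip: "speed-lipschitz_on {0..T} \<xi>"
  proof (rule lipschitz_onI[OF _ speed_nonneg])
    fix x y assume xy: "x \<in> {0..T}" "y \<in> {0..T}"
    have "(\<lambda>n. dist (P n x) (P n y)) \<longlonglongrightarrow> dist (\<xi> x) (\<xi> y)" by (intro tendsto_dist Plim xy)
    then show "dist (\<xi> x) (\<xi> y) \<le> speed * dist x y"
    proof (rule tendsto_upperbound)
      show "\<forall>\<^sub>F n in sequentially. dist (P n x) (P n y) \<le> speed * dist x y"
        using xy lipschitz_onD[OF euler_path_lipschitz[OF h \<xi>0]] by (simp add: P_def)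
    qed simp
  qed
  \<comment> \<open>The state frozen at the beginning of the cell of \<open>s\<close> is within \<open>speed * h n\<close> of the path at \<open>s\<close>.\<close>
  have Vlim: "(\<lambda>n. V n s) \<longlonglongrightarrow> G s" if s: "s \<in> {0..T}" for s
  proof -
    define y where "y n = euler (h n) \<xi>0 (cell (h n) s)" for n
    have "norm (y n - P n s) \<le> speed * h n" for n
    proof -
      have c: "0 \<le> real (cell (h n) s) * h n" "real (cell (h n) s) * h n \<le> s" "s - real (cell (h n) s) * h n \<le> h n"
        using cell_bounds[OF h, of s n] h[of n] s by (auto simp: algebra_simps less_imp_le)
      have "norm (P n s - y n) \<le> speed * (s - real (cell (h n) s) * h n)"
        using norm_euler_path_diff[OF h[of n] \<xi>0 c(1,2)] euler_path_grid[OF h \<xi>0, of n "cell (h n) s"] by (simp add: P_def y_def)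
      also have "\<dots> \<le> speed * h n" using c speed_nonneg by (intro mult_left_mono) auto
      finally show ?thesis by (simp add: norm_minus_commute)
    qed
    then have "(\<lambda>n. y n - P n s) \<longlonglongrightarrow> 0"
      by (intro Lim_null_comparison[OF _ tendsto_mult_right_zero[OF hlim, of speed]]) auto
    from tendsto_add[OF this Plim[OF s]] have "y \<longlonglongrightarrow> \<xi> s" by simp
    then show ?thesis
      unfolding V_def euler_velocity_def G_def using isCont_tendsto_compose[OF H_continuous, of y "\<xi> s" sequentially s]
      by (simp add: y_def)
  qed
  have dom: "G integrable_on {0..t}" "(\<lambda>n. integral {0..t} (V n)) \<longlonglongrightarrow> integral {0..t} G"
    if "t \<in> {0..T}" for t
  proof -
    have Vi: "V n integrable_on {0..t}" for n
      unfolding V_def by (rule euler_velocity_integrable[OF h \<xi>0 order_refl])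
    have Vb: "norm (V n x) \<le> B" for n x unfolding V_def by (rule euler_velocity_bound[OF h \<xi>0])
    have Vl: "(\<lambda>n. V n x) \<longlonglongrightarrow> G x" if "x \<in> {0..t}" for x
      using that \<open>t \<in> {0..T}\<close> by (intro Vlim) auto
    show "G integrable_on {0..t}" "(\<lambda>n. integral {0..t} (V n)) \<longlonglongrightarrow> integral {0..t} G"
      using dominated_convergence[OF Vi integrable_const_ivl[of B 0 t] Vb Vl] by blast+
  qed
  have off: "off_axis (\<xi> t - \<xi> 0 - integral {0..t} G) = 0" if t: "t \<in> {0..T}" for t
  proof -
    have "(\<lambda>n. off_axis (P n t - \<xi>0 - integral {0..t} (V n))) \<longlonglongrightarrow> off_axis (\<xi> t - \<xi>0 - integral {0..t} G)"
      unfolding off_axis_def by (intro tendsto_intros Plim dom t)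
    moreover have "off_axis (P n t - \<xi>0 - integral {0..t} (V n)) = 0" for n
      using off_axis_euler_path[OF h \<xi>0, of t n] t by (simp add: P_def V_def)
    ultimately show ?thesis by (simp add: LIMSEQ_const_iff \<xi>_0)
  qed
  have slack: "(\<lambda>n. 2 * (speed + B) * h n) \<longlonglongrightarrow> 0"
    by (rule tendsto_mult_right_zero[OF hlim])
  \<comment> \<open>Used with \<open>g\<close> the distance of \<open>u\<close> to one of its bounds, which is Lipschitz in the state.\<close>
  have strict: "\<forall>\<^sub>F n in sequentially. \<forall>x\<in>{r..s}. 0 < g (P n x)"
    if rs: "0 \<le> r" "r \<le> s" "s \<le> T" and pos: "\<forall>x\<in>{r..s}. 0 < g (\<xi> x)"
      and g: "\<And>x y. \<bar>g x - g y\<bar> \<le> K * norm (x - y)" "continuous_on UNIV g" for r s K and g :: "'a \<Rightarrow> real"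
  proof -
    have "{r..s} \<subseteq> {0..T}" using rs by auto
    then have "continuous_on {r..s} (\<lambda>x. g (\<xi> x))"
      by (intro continuous_on_compose2[OF g(2)] continuous_on_subset[OF cont]) auto
    then obtain m where m: "m \<in> {r..s}" "\<forall>x\<in>{r..s}. g (\<xi> m) \<le> g (\<xi> x)"
      using continuous_attains_inf[of "{r..s}" "\<lambda>x. g (\<xi> x)"] rs by auto
    have gm: "0 < g (\<xi> m)" using pos m by auto
    obtain N where N: "\<And>n x. n \<ge> N \<Longrightarrow> x \<in> {0..T} \<Longrightarrow> norm (P n x - \<xi> x) < g (\<xi> m) / (\<bar>K\<bar> + 1)"
      using uc[of "g (\<xi> m) / (\<bar>K\<bar> + 1)"] gm by auto
    have "0 < g (P n x)" if "n \<ge> N" "x \<in> {r..s}" for n x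
    proof -
      have "\<bar>g (P n x) - g (\<xi> x)\<bar> \<le> K * norm (P n x - \<xi> x)" by (rule g)
      also have "\<dots> \<le> (\<bar>K\<bar> + 1) * norm (P n x - \<xi> x)" by (intro mult_right_mono) auto
      also have "\<dots> < g (\<xi> m)"
        using N[OF that(1), of x] that rs by (auto simp: field_simps)
      finally show ?thesis using m(2) that(2) by fastforce
    qed
    then show ?thesis using eventually_sequentially by blast
  qed
  have q_diff: "\<bar>q \<bullet> x - q \<bullet> y\<bar> \<le> norm q * norm (x - y)" for x y
    using Cauchy_Schwarz_ineq2[of q "x - y"] by (simp add: inner_diff_right)
  have a_diff: "\<bar>a \<bullet> x - a \<bullet> y\<bar> \<le> norm (x - y)" for x y
    using Cauchy_Schwarz_ineq2[of a "x - y"] by (simp add: inner_diff_right norm_a)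
  have slope_diff: "slope_bound * \<bar>q \<bullet> x - q \<bullet> y\<bar> \<le> slope_bound * norm q * norm (x - y)" for x y
    using mult_left_mono[OF q_diff slope_bound_nonneg] by (simp add: mult.assoc)
  have below: "a \<bullet> \<xi> s - a \<bullet> \<xi> r \<le> a \<bullet> integral {0..s} G - a \<bullet> integral {0..r} G"
    if rs: "0 \<le> r" "r \<le> s" "s \<le> T" and pos: "\<forall>x\<in>{r..s}. lower (q \<bullet> \<xi> x) < a \<bullet> \<xi> x" for r s
  proof -
    have mem: "r \<in> {0..T}" "s \<in> {0..T}" using rs by auto
    have lim_a: "(\<lambda>n. a \<bullet> P n s - a \<bullet> P n r) \<longlonglongrightarrow> a \<bullet> \<xi> s - a \<bullet> \<xi> r"
      and lim_I: "(\<lambda>n. a \<bullet> integral {0..s} (V n) - a \<bullet> integral {0..r} (V n)) \<longlonglongrightarrow>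
        a \<bullet> integral {0..s} G - a \<bullet> integral {0..r} G"
      by (intro tendsto_intros Plim dom mem)+
    have "\<forall>\<^sub>F n in sequentially. \<forall>x\<in>{r..s}. 0 < a \<bullet> P n x - lower (q \<bullet> P n x)"
    proof (rule strict[OF rs, where K = "slope_bound * norm q + 1"])
      show "\<bar>a \<bullet> x - lower (q \<bullet> x) - (a \<bullet> y - lower (q \<bullet> y))\<bar> \<le> (slope_bound * norm q + 1) * norm (x - y)" for x y
        using lower_lipschitz[of "q \<bullet> x" "q \<bullet> y"] slope_diff[of x y] a_diff[of x y]
        unfolding distrib_right by linarith
    qed (use pos in \<open>auto intro!: continuous_intros continuous_lower\<close>)
    then have ev: "\<forall>\<^sub>F n in sequentially. a \<bullet> P n s - a \<bullet> P n r \<le>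
        a \<bullet> integral {0..s} (V n) - a \<bullet> integral {0..r} (V n) + 2 * (speed + B) * h n"
      by eventually_elim (use euler_path_increment(1)[OF h \<xi>0 rs(1,2)] in \<open>simp add: P_def V_def\<close>)
    have "a \<bullet> \<xi> s - a \<bullet> \<xi> r \<le> a \<bullet> integral {0..s} G - a \<bullet> integral {0..r} G + 0"
      by (rule tendsto_le[OF _ tendsto_add[OF lim_I slack] lim_a ev]) simp
    then show ?thesis by simp
  qed
  have above: "a \<bullet> integral {0..s} G - a \<bullet> integral {0..r} G \<le> a \<bullet> \<xi> s - a \<bullet> \<xi> r"
    if rs: "0 \<le> r" "r \<le> s" "s \<le> T" and pos: "\<forall>x\<in>{r..s}. a \<bullet> \<xi> x < upper (q \<bullet> \<xi> x)" for r s
  proof -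
    have mem: "r \<in> {0..T}" "s \<in> {0..T}" using rs by auto
    have lim_a: "(\<lambda>n. a \<bullet> P n s - a \<bullet> P n r) \<longlonglongrightarrow> a \<bullet> \<xi> s - a \<bullet> \<xi> r"
      and lim_I: "(\<lambda>n. a \<bullet> integral {0..s} (V n) - a \<bullet> integral {0..r} (V n)) \<longlonglongrightarrow>
        a \<bullet> integral {0..s} G - a \<bullet> integral {0..r} G"
      by (intro tendsto_intros Plim dom mem)+
    have "\<forall>\<^sub>F n in sequentially. \<forall>x\<in>{r..s}. 0 < upper (q \<bullet> P n x) - a \<bullet> P n x"
    proof (rule strict[OF rs, where K = "slope_bound * norm q + 1"])
      show "\<bar>upper (q \<bullet> x) - a \<bullet> x - (upper (q \<bullet> y) - a \<bullet> y)\<bar> \<le> (slope_bound * norm q + 1) * norm (x - y)" for x y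
        using upper_lipschitz[of "q \<bullet> x" "q \<bullet> y"] slope_diff[of x y] a_diff[of x y]
        unfolding distrib_right by linarith
    qed (use pos in \<open>auto intro!: continuous_intros continuous_upper\<close>)
    then have ev: "\<forall>\<^sub>F n in sequentially. a \<bullet> integral {0..s} (V n) - a \<bullet> integral {0..r} (V n) \<le>
        a \<bullet> P n s - a \<bullet> P n r + 2 * (speed + B) * h n"
      by eventually_elim (use euler_path_increment(2)[OF h \<xi>0 rs(1,2)] in \<open>simp add: P_def V_def\<close>)
    have "a \<bullet> integral {0..s} G - a \<bullet> integral {0..r} G \<le> a \<bullet> \<xi> s - a \<bullet> \<xi> r + 0"
      by (rule tendsto_le[OF _ tendsto_add[OF lim_a slack] lim_I ev]) simp
    then show ?thesis by simp
  qed
  have "reflected_motion T G \<xi>"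
    unfolding reflected_motion_def using cont dom(1)[of T] T \<xi>_states off below above by auto
  then show ?thesis using \<xi>_0 lip unfolding G_def by blast
qed

end

section \<open>Restricting and gluing solutions\<close>

text \<open>A strong form of Caratheodory solutions that is easy to restrict and to glue.  Differentiability is
  required in the open interval only, so that two-sided derivatives can be used throughout.\<close>

definition regular_solution ::
  "'a::real_normed_vector set \<Rightarrow> 'a set \<Rightarrow> ('a \<Rightarrow> 'b \<Rightarrow> 'a) \<Rightarrow> (real \<Rightarrow> 'b) \<Rightarrow> real \<Rightarrow> (real \<Rightarrow> 'a) \<Rightarrow> bool"
where
  "regular_solution C E f w T \<xi> \<longleftrightarrow>
     (\<exists>L. L-lipschitz_on {0..T} \<xi>) \<and> (\<forall>t\<in>{0..T}. \<xi> t \<in> C) \<and>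
     (\<exists>N. countable N \<and> (\<forall>t. 0 < t \<longrightarrow> t < T \<longrightarrow> t \<notin> N \<longrightarrow>
        (\<xi> has_vector_derivative ext_proj C E (\<xi> t) (f (\<xi> t) (w t))) (at t)))"

lemma regular_solution_imp_caratheodory:
  assumes "regular_solution C E f w T \<xi>"
  shows "caratheodory_solution_on C E f w T \<xi>"
  unfolding caratheodory_solution_on_def
proof (intro conjI)
  show "absolutely_continuous_on {0..T} \<xi>" "\<forall>t\<in>{0..T}. \<xi> t \<in> C"
    using assms lipschitz_on_imp_absolutely_continuous_on unfolding regular_solution_def by blast+
  obtain N where N: "countable N" and der: "\<And>t. 0 < t \<Longrightarrow> t < T \<Longrightarrow> t \<notin> N \<Longrightarrow>
      (\<xi> has_vector_derivative ext_proj C E (\<xi> t) (f (\<xi> t) (w t))) (at t)"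
    using assms unfolding regular_solution_def by blast
  have "N \<union> {0, T} \<in> null_sets lborel" using N by (intro countable_imp_null_set_lborel) auto
  then have "N \<union> {0, T} \<in> null_sets lebesgue" by (rule null_sets_completionI)
  then have "AE t in lebesgue. t \<notin> N \<union> {0, T}" by (rule AE_not_in)
  then have "AE t in lebesgue. t \<in> {0..T} \<longrightarrow>
      (\<xi> has_vector_derivative ext_proj C E (\<xi> t) (f (\<xi> t) (w t))) (at t within {0..T})"
    by eventually_elim (auto intro!: has_vector_derivative_at_within[OF der])
  then show "AE t in lebesgue_on {0..T}.
      (\<xi> has_vector_derivative ext_proj C E (\<xi> t) (f (\<xi> t) (w t))) (at t within {0..T})"
    by (subst AE_restrict_space_iff) auto
qed

lemma regular_solution_restrict:
  assumes \<xi>: "regular_solution C E f w T \<xi>" and T': "T' \<le> T"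
    and eq: "\<And>t. 0 \<le> t \<Longrightarrow> t \<le> T' \<Longrightarrow> \<eta> t = \<xi> t"
  shows "regular_solution C E f w T' \<eta>"
  unfolding regular_solution_def
proof (intro conjI)
  obtain L where "L-lipschitz_on {0..T} \<xi>" using \<xi> unfolding regular_solution_def by blast
  then have "L-lipschitz_on {0..T'} \<xi>" using T' by (auto intro: lipschitz_on_subset)
  then have "L-lipschitz_on {0..T'} \<eta>" using eq by (auto simp: lipschitz_on_def)
  then show "\<exists>L. L-lipschitz_on {0..T'} \<eta>" by blast
  show "\<forall>t\<in>{0..T'}. \<eta> t \<in> C" using \<xi> eq T' unfolding regular_solution_def by auto
  obtain N where N: "countable N" and der: "\<And>t. 0 < t \<Longrightarrow> t < T \<Longrightarrow> t \<notin> N \<Longrightarrow>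
      (\<xi> has_vector_derivative ext_proj C E (\<xi> t) (f (\<xi> t) (w t))) (at t)"
    using \<xi> unfolding regular_solution_def by blast
  have "(\<eta> has_vector_derivative ext_proj C E (\<eta> t) (f (\<eta> t) (w t))) (at t)"
    if t: "0 < t" "t < T'" "t \<notin> N" for t
  proof -
    have "(\<xi> has_vector_derivative ext_proj C E (\<xi> t) (f (\<xi> t) (w t))) (at t)"
      using t T' by (intro der) auto
    then have "(\<eta> has_vector_derivative ext_proj C E (\<xi> t) (f (\<xi> t) (w t))) (at t)"
      by (rule has_vector_derivative_transform_within_open[of _ _ t "{0<..<T'}"]) (use t eq in auto)
    then show ?thesis using eq[of t] t by simp
  qed
  then show "\<exists>N. countable N \<and> (\<forall>t. 0 < t \<longrightarrow> t < T' \<longrightarrow> t \<notin> N \<longrightarrow>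
      (\<eta> has_vector_derivative ext_proj C E (\<eta> t) (f (\<eta> t) (w t))) (at t))"
    using N by blast
qed

lemma regular_solution_concat:
  assumes \<xi>: "regular_solution C E f w T \<xi>" and T: "0 \<le> T"
    and \<eta>: "regular_solution C E f (\<lambda>s. w (T + s)) T' \<eta>" and join: "\<eta> 0 = \<xi> T"
  shows "regular_solution C E f w (T + T') (\<lambda>t. if t \<le> T then \<xi> t else \<eta> (t - T))"
    (is "regular_solution C E f w (T + T') ?\<zeta>")
  unfolding regular_solution_def
proof (intro conjI)
  obtain L where L: "L-lipschitz_on {0..T} \<xi>" using \<xi> unfolding regular_solution_def by blast
  obtain L' where L': "L'-lipschitz_on {0..T'} \<eta>" using \<eta> unfolding regular_solution_def by blast
  have "(max L L')-lipschitz_on {0..T} \<xi>" by (rule lipschitz_on_le[OF L]) simp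
  moreover have "(max L L')-lipschitz_on {T..T + T'} (\<lambda>t. \<eta> (t - T))"
  proof (rule lipschitz_onI)
    fix x y assume "x \<in> {T..T + T'}" "y \<in> {T..T + T'}"
    then have "dist (\<eta> (x - T)) (\<eta> (y - T)) \<le> max L L' * dist (x - T) (y - T)"
      by (intro lipschitz_onD[OF lipschitz_on_le[OF L']]) auto
    then show "dist (\<eta> (x - T)) (\<eta> (y - T)) \<le> max L L' * dist x y" by (simp add: dist_norm)
  qed (use lipschitz_on_nonneg[OF L] in simp)
  ultimately have "(max L L')-lipschitz_on {0..T + T'} ?\<zeta>"
    by (rule lipschitz_on_concat) (simp add: join)
  then show "\<exists>L. L-lipschitz_on {0..T + T'} ?\<zeta>" by blast
  show "\<forall>t\<in>{0..T + T'}. ?\<zeta> t \<in> C" using \<xi> \<eta> unfolding regular_solution_def by auto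
  obtain N where N: "countable N" and der: "\<And>t. 0 < t \<Longrightarrow> t < T \<Longrightarrow> t \<notin> N \<Longrightarrow>
      (\<xi> has_vector_derivative ext_proj C E (\<xi> t) (f (\<xi> t) (w t))) (at t)"
    using \<xi> unfolding regular_solution_def by blast
  obtain N' where N': "countable N'" and der': "\<And>t. 0 < t \<Longrightarrow> t < T' \<Longrightarrow> t \<notin> N' \<Longrightarrow>
      (\<eta> has_vector_derivative ext_proj C E (\<eta> t) (f (\<eta> t) (w (T + t)))) (at t)"
    using \<eta> unfolding regular_solution_def by blast
  have "(?\<zeta> has_vector_derivative ext_proj C E (?\<zeta> t) (f (?\<zeta> t) (w t))) (at t)"
    if t: "0 < t" "t < T + T'" "t \<notin> N \<union> {T} \<union> (\<lambda>s. T + s) ` N'" for t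
  proof (cases "t < T")
    case True
    have "(\<xi> has_vector_derivative ext_proj C E (\<xi> t) (f (\<xi> t) (w t))) (at t)"
      using True t by (intro der) auto
    then have "(?\<zeta> has_vector_derivative ext_proj C E (\<xi> t) (f (\<xi> t) (w t))) (at t)"
      by (rule has_vector_derivative_transform_within_open[of _ _ t "{..<T}"]) (use True in auto)
    then show ?thesis using True by simp
  next
    case False
    then have tT: "T < t" using t by auto
    have "t - T \<notin> N'" using t by force
    then have "(\<eta> has_vector_derivative ext_proj C E (\<eta> (t - T)) (f (\<eta> (t - T)) (w (T + (t - T))))) (at (t - T))"
      using tT t by (intro der') auto
    then have "(\<eta> has_vector_derivative ext_proj C E (\<eta> (t - T)) (f (\<eta> (t - T)) (w t))) (at (t - T))"
      by simp
    moreover have "((\<lambda>s. s - T) has_vector_derivative 1) (at t)"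
      by (auto intro!: derivative_eq_intros)
    ultimately have "(\<eta> \<circ> (\<lambda>s. s - T) has_vector_derivative
        1 *\<^sub>R ext_proj C E (\<eta> (t - T)) (f (\<eta> (t - T)) (w t))) (at t)"
      by (intro vector_diff_chain_at)
    then have "(?\<zeta> has_vector_derivative 1 *\<^sub>R ext_proj C E (\<eta> (t - T)) (f (\<eta> (t - T)) (w t))) (at t)"
      by (rule has_vector_derivative_transform_within_open[of _ _ t "{T<..}"]) (use tT in auto)
    then show ?thesis using tT by simp
  qed
  moreover have "countable (N \<union> {T} \<union> (\<lambda>s. T + s) ` N')" using N N' by auto
  ultimately show "\<exists>N. countable N \<and> (\<forall>t. 0 < t \<longrightarrow> t < T + T' \<longrightarrow> t \<notin> N \<longrightarrow>
      (?\<zeta> has_vector_derivative ext_proj C E (?\<zeta> t) (f (?\<zeta> t) (w t))) (at t))"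
    by blast
qed

text \<open>Solutions over a fixed step length, available from every state, are glued by dependent choice.  The
  limit function reads its value at \<open>t\<close> from the first partial solution that reaches \<open>t\<close>.\<close>

lemma caratheodory_solution_by_steps:
  assumes \<tau>: "0 < \<tau>" and \<xi>0: "\<xi>0 \<in> C"
    and step: "\<And>k y. y \<in> C \<Longrightarrow>
      \<exists>\<eta>. regular_solution C E f (\<lambda>s. w (real k * \<tau> + s)) \<tau> \<eta> \<and> \<eta> 0 = y"
  shows "\<exists>\<xi>. caratheodory_solution C E f w \<xi> \<and> \<xi> 0 = \<xi>0"
proof -
  have "\<exists>X. \<forall>n. (regular_solution C E f w (real n * \<tau>) (X n) \<and> X n 0 = \<xi>0) \<and>
      (\<forall>t\<in>{0..real n * \<tau>}. X (Suc n) t = X n t)"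
  proof (rule dependent_nat_choice)
    have "0-lipschitz_on {0..real 0 * \<tau>} (\<lambda>_. \<xi>0)" by (simp add: lipschitz_on_def)
    then show "\<exists>x. regular_solution C E f w (real 0 * \<tau>) x \<and> x 0 = \<xi>0"
      using \<xi>0 unfolding regular_solution_def
      by (intro exI[of _ "\<lambda>_. \<xi>0"] conjI exI[of _ "0::real"] exI[of _ "{}"]) auto
  next
    fix x n assume x: "regular_solution C E f w (real n * \<tau>) x \<and> x 0 = \<xi>0"
    have n: "0 \<le> real n * \<tau>" using \<tau> by simp
    then have "x (real n * \<tau>) \<in> C" using x unfolding regular_solution_def by auto
    from step[OF this, of n] obtain \<eta> where \<eta>: "regular_solution C E f (\<lambda>s. w (real n * \<tau> + s)) \<tau> \<eta>"
      "\<eta> 0 = x (real n * \<tau>)" by blast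
    let ?y = "\<lambda>t. if t \<le> real n * \<tau> then x t else \<eta> (t - real n * \<tau>)"
    have "regular_solution C E f w (real n * \<tau> + \<tau>) ?y"
      using regular_solution_concat[of C E f w "real n * \<tau>" x \<tau> \<eta>] n \<eta> x by blast
    moreover have "real n * \<tau> + \<tau> = real (Suc n) * \<tau>" by (simp add: algebra_simps)
    ultimately show "\<exists>y. (regular_solution C E f w (real (Suc n) * \<tau>) y \<and> y 0 = \<xi>0) \<and>
        (\<forall>t\<in>{0..real n * \<tau>}. y t = x t)"
      using x n by (intro exI[of _ ?y]) auto
  qed
  then obtain X where all: "\<forall>n. (regular_solution C E f w (real n * \<tau>) (X n) \<and> X n 0 = \<xi>0) \<and>
      (\<forall>t\<in>{0..real n * \<tau>}. X (Suc n) t = X n t)"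
    by blast
  then have X: "regular_solution C E f w (real n * \<tau>) (X n)" "X n 0 = \<xi>0" for n
    by blast+
  have Suc: "X (Suc n) t = X n t" if "0 \<le> t" "t \<le> real n * \<tau>" for n t
    using all that by simp
  have stable: "X m t = X n t" if "n \<le> m" "0 \<le> t" "t \<le> real n * \<tau>" for m n t
    using that(1)
  proof (induction m rule: dec_induct)
    case (step m)
    have "real n * \<tau> \<le> real m * \<tau>" using step \<tau> by (intro mult_right_mono) auto
    then show ?case using Suc[of t m] step that by auto
  qed simp
  define \<xi> where "\<xi> t = X (nat \<lceil>t / \<tau>\<rceil>) t" for t
  have "\<xi> t = X n t" if t: "0 \<le> t" "t \<le> real n * \<tau>" for n t
  proof -
    have "t / \<tau> \<le> real n" using t \<tau> by (simp add: field_simps)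
    then have "nat \<lceil>t / \<tau>\<rceil> \<le> n" by (simp add: ceiling_le_iff)
    moreover have "t \<le> real (nat \<lceil>t / \<tau>\<rceil>) * \<tau>"
    proof -
      have "t / \<tau> \<le> real (nat \<lceil>t / \<tau>\<rceil>)" by (rule real_nat_ceiling_ge)
      then show ?thesis using \<tau> by (simp only: pos_divide_le_eq)
    qed
    ultimately show ?thesis unfolding \<xi>_def using stable t by metis
  qed
  note \<xi>_eq = this
  have "regular_solution C E f w T \<xi>" if "0 < T" for T
  proof -
    define n where "n = nat \<lceil>T / \<tau>\<rceil>"
    have "T / \<tau> \<le> real n" unfolding n_def by (rule real_nat_ceiling_ge)
    then have "T \<le> real n * \<tau>" using \<tau> by (simp only: pos_divide_le_eq)
    then show ?thesis by (rule regular_solution_restrict[OF X(1)]) (auto intro!: \<xi>_eq order_trans[OF _ \<open>T \<le> real n * \<tau>\<close>])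
  qed
  then have "caratheodory_solution C E f w \<xi>"
    unfolding caratheodory_solution_def by (blast intro: regular_solution_imp_caratheodory)
  moreover have "\<xi> 0 = \<xi>0" using \<xi>_eq[of 0 0] X(2) by simp
  ultimately show ?thesis by blast
qed

section \<open>Piecewise continuous inputs\<close>

lemma PC_isCont:
  assumes "w \<in> PC"
  shows "\<exists>X. countable X \<and> (\<forall>s>0. s \<notin> X \<longrightarrow> isCont w s)"
proof -
  obtain t :: "nat \<Rightarrow> real" where t: "\<forall>s\<in>{0..} - range t. continuous (at s within {0..}) w"
    using assms unfolding PC_def by blast
  have "isCont w s" if "s > 0" "s \<notin> range t" for s
  proof -
    have "continuous (at s within {0..}) w" using t that by auto
    then show ?thesis using at_within_interior[of s "{0..}"] that by (simp add: interior_real_atLeast)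
  qed
  then show ?thesis by (intro exI[of _ "range t"]) auto
qed

text \<open>Right-continuity at \<open>t 0 = 0\<close> closes the gap at the left end; the next discontinuity is at \<open>t 1\<close>.\<close>

lemma PC_continuous_initially:
  fixes w :: "real \<Rightarrow> 'b::topological_space"
  assumes "w \<in> PC"
  shows "\<exists>\<tau>>0. continuous_on {0..\<tau>} w"
proof -
  obtain t :: "nat \<Rightarrow> real" where t: "t 0 = 0" "\<And>k. t k < t (Suc k)"
    "\<And>s. s \<in> {0..} - range t \<Longrightarrow> continuous (at s within {0..}) w"
    "\<And>k. (w \<longlongrightarrow> w (t k)) (at_right (t k))"
    using assms unfolding PC_def by blast
  define \<tau> where "\<tau> = t 1 / 2"
  have t1: "0 < t 1" using t(1) t(2)[of 0] by simp
  have "continuous (at s within {0..\<tau>}) w" if s: "s \<in> {0..\<tau>}" for s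
  proof (cases "s = 0")
    case True
    have "(w \<longlongrightarrow> w 0) (at_right 0)" using t(4)[of 0] t(1) by simp
    then show ?thesis using True t1 by (simp add: continuous_within at_within_Icc_at_right \<tau>_def)
  next
    case False
    have "s \<notin> range t"
    proof
      assume "s \<in> range t"
      then obtain k where k: "s = t k" by blast
      have "strict_mono t" using t(2) by (rule strict_monoI_Suc)
      then have "t 1 \<le> t k" if "k \<noteq> 0" using that by (simp add: strict_mono_less_eq)
      then show False using k s False t(1) t1 by (cases "k = 0") (auto simp: \<tau>_def)
    qed
    then have "continuous (at s within {0..}) w" using s by (intro t(3)) auto
    then show ?thesis by (rule continuous_within_subset) auto
  qed
  then have "continuous_on {0..\<tau>} w" by (simp add: continuous_on_eq_continuous_within)
  then show ?thesis using t1 by (intro exI[of _ \<tau>]) (auto simp: \<tau>_def)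
qed

section \<open>Existence of solutions\<close>

context sector_system
begin

text \<open>Scaling the values of \<open>F\<close> back to norm at most \<open>B\<close> yields a bounded field.  Its solution has speed at
  most \<open>clip_lipschitz * B\<close> and therefore stays within distance \<open>\<rho>\<close> of \<open>\<xi>0\<close>, where the values
  of \<open>F\<close> were not changed.\<close>

lemma local_solution:
  fixes F :: "'a \<Rightarrow> 'c::t2_space \<Rightarrow> 'a"
  assumes F: "continuous_on UNIV (\<lambda>(\<xi>, w). F \<xi> w)" and T: "0 < T" and \<xi>0: "\<xi>0 \<in> states"
    and X: "countable X" and w: "\<And>s. 0 < s \<Longrightarrow> s < T \<Longrightarrow> s \<notin> X \<Longrightarrow> isCont w s"
    and B: "0 < B"
    and bound: "\<And>\<xi> s. \<xi> \<in> states \<Longrightarrow> norm (\<xi> - \<xi>0) \<le> \<rho> \<Longrightarrow> 0 < s \<Longrightarrow> s < T \<Longrightarrow> norm (F \<xi> (w s)) \<le> B"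
    and \<rho>: "clip_lipschitz * B * T \<le> \<rho>"
  shows "\<exists>\<xi>. regular_solution states E F w T \<xi> \<and> \<xi> 0 = \<xi>0"
proof -
  define sat where "sat v = (B / max B (norm v)) *\<^sub>R v" for v :: 'a
  have sat_bound: "norm (sat v) \<le> B" for v
    using B by (auto simp: sat_def field_simps max_def)
  have sat_id: "sat v = v" if "norm v \<le> B" for v
    using that B by (simp add: sat_def max_def)
  have sat_cont: "isCont sat v" for v
    unfolding sat_def using B by (intro continuous_intros) (auto simp: max_def)
  \<comment> \<open>Outside \<open>(0, T)\<close> nothing is known about \<open>w\<close>; the constant value \<open>w 0\<close> creates at most two new discontinuities.\<close>
  define w' where "w' s = (if 0 < s \<and> s < T then w s else w 0)" for s
  have w': "isCont w' s" if s: "s \<notin> X \<union> {0, T}" for s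
  proof -
    consider "0 < s" "s < T" | "s < 0" | "T < s" using s by fastforce
    then show ?thesis
    proof cases
      case 1
      have "\<forall>\<^sub>F x in nhds s. x \<in> {0<..<T}" using 1 by (intro eventually_nhds_in_open) auto
      then have "\<forall>\<^sub>F x in nhds s. w' x = w x" by eventually_elim (simp add: w'_def)
      then show ?thesis using w[of s] 1 s isCont_cong by blast
    next
      case 2
      have "\<forall>\<^sub>F x in nhds s. x \<in> {..<0}" using 2 by (intro eventually_nhds_in_open) auto
      then have "\<forall>\<^sub>F x in nhds s. w' x = w 0" by eventually_elim (simp add: w'_def)
      then show ?thesis using isCont_cong[of w' "\<lambda>_. w 0" s] by simp
    next
      case 3
      have "\<forall>\<^sub>F x in nhds s. x \<in> {T<..}" using 3 by (intro eventually_nhds_in_open) auto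
      then have "\<forall>\<^sub>F x in nhds s. w' x = w 0" by eventually_elim (simp add: w'_def)
      then show ?thesis using isCont_cong[of w' "\<lambda>_. w 0" s] by simp
    qed
  qed
  define H where "H y s = sat (F y (w' s))" for y s
  have joint: "isCont (\<lambda>s. sat (F (y s) (v s))) s" if "isCont y s" "isCont v s"
    for y :: "'d::t2_space \<Rightarrow> 'a" and v s
  proof -
    have "isCont (\<lambda>p. F (fst p) (snd p)) (y s, v s)"
      using F by (simp add: continuous_on_eq_continuous_at split_def)
    moreover have "isCont (\<lambda>s. (y s, v s)) s" using that by (rule continuous_Pair)
    ultimately have "isCont (\<lambda>s. F (y s) (v s)) s"
      using isCont_o2[of s "\<lambda>s. (y s, v s)" "\<lambda>p. F (fst p) (snd p)"] by simp
    then show ?thesis by (rule isCont_o2) (rule sat_cont)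
  qed
  interpret bounded_sector_field a q E k1 k2 H B
  proof unfold_locales
    fix y r s
    have "continuous_on (- (X \<union> {0, T})) (H y)"
      unfolding H_def by (intro continuous_at_imp_continuous_on ballI joint w') auto
    then have "H y \<in> borel_measurable borel"
      using X by (intro borel_measurable_continuous_countable_exceptions[of "X \<union> {0, T}"]) auto
    then have "H y \<in> borel_measurable (lebesgue_on {r..s})"
      by (intro measurable_restrict_space1 measurable_completion) simp
    then show "H y integrable_on {r..s}"
      by (rule measurable_bounded_by_integrable_imp_integrable[OF _ integrable_const_ivl[of B r s]])
        (auto simp: H_def sat_bound)
  next
    show "norm (H y s) \<le> B" for y s by (simp add: H_def sat_bound)
    show "isCont (\<lambda>y. H y s) y" for y s unfolding H_def by (intro joint continuous_intros)
  qed
  obtain \<xi> where \<xi>: "\<xi> 0 = \<xi>0" "speed-lipschitz_on {0..T} \<xi>" "reflected_motion T (\<lambda>s. H (\<xi> s) s) \<xi>"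
    using reflected_motion_exists[OF \<xi>0, of T] T by auto
  have states: "\<xi> t \<in> states" if "t \<in> {0..T}" for t
    using \<xi>(3) that unfolding reflected_motion_def by blast
  have G: "isCont (\<lambda>s. H (\<xi> s) s) t" if "0 < t" "t < T" "t \<notin> X" for t
  proof -
    have "isCont \<xi> t"
      using that lipschitz_on_continuous_on[OF \<xi>(2)] by (intro continuous_on_interior) auto
    then show ?thesis unfolding H_def using that by (intro joint w') auto
  qed
  have eq: "H (\<xi> t) t = F (\<xi> t) (w t)" if t: "0 < t" "t < T" for t
  proof -
    have "norm (\<xi> t - \<xi>0) \<le> speed * t"
      using lipschitz_onD[OF \<xi>(2), of t 0] t \<xi>(1) by (simp add: dist_norm)
    also have "\<dots> \<le> speed * T" using t speed_nonneg by (intro mult_left_mono) auto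
    also have "\<dots> \<le> \<rho>" using \<rho> by (simp add: speed_def)
    finally have "norm (F (\<xi> t) (w t)) \<le> B" using t states by (intro bound) auto
    then show ?thesis using t by (simp add: H_def w'_def sat_id)
  qed
  obtain N where "countable N" "\<And>t. 0 < t \<Longrightarrow> t < T \<Longrightarrow> t \<notin> N \<Longrightarrow>
      (\<xi> has_vector_derivative ext_proj states E (\<xi> t) (H (\<xi> t) t)) (at t)"
    using reflected_motion_derivative[OF \<xi>(3) X G] by blast
  then have "regular_solution states E F w T \<xi>"
    unfolding regular_solution_def using \<xi>(2) states eq by auto
  then show ?thesis using \<xi>(1) by blast
qed

theorem solution_exists_locally:
  fixes F :: "'a \<Rightarrow> 'c::metric_space \<Rightarrow> 'a"
  assumes F: "continuous_on UNIV (\<lambda>(\<xi>, w). F \<xi> w)" and w: "w \<in> PC" and \<xi>0: "\<xi>0 \<in> states"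
  shows "\<exists>T>0. \<exists>\<xi>. caratheodory_solution_on states E F w T \<xi> \<and> \<xi> 0 = \<xi>0"
proof -
  obtain X where X: "countable X" "\<And>s. s > 0 \<Longrightarrow> s \<notin> X \<Longrightarrow> isCont w s"
    using PC_isCont[OF w] by blast
  obtain \<tau> where \<tau>: "\<tau> > 0" "continuous_on {0..\<tau>} w" using PC_continuous_initially[OF w] by blast
  have "compact (cball \<xi>0 1 \<times> w ` {0..\<tau>})"
    by (intro compact_Times compact_cball compact_continuous_image \<tau>) auto
  then have "bounded ((\<lambda>(\<xi>, w). F \<xi> w) ` (cball \<xi>0 1 \<times> w ` {0..\<tau>}))"
    by (intro compact_imp_bounded compact_continuous_image continuous_on_subset[OF F]) auto
  then obtain B where B: "B > 0" "\<And>x. x \<in> (\<lambda>(\<xi>, w). F \<xi> w) ` (cball \<xi>0 1 \<times> w ` {0..\<tau>}) \<Longrightarrow> norm x \<le> B"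
    unfolding bounded_pos by blast
  define T where "T = min \<tau> (1 / (clip_lipschitz * B))"
  have T: "0 < T" "T \<le> \<tau>" using \<tau> B clip_lipschitz_ge by (auto simp: T_def)
  have "\<exists>\<xi>. regular_solution states E F w T \<xi> \<and> \<xi> 0 = \<xi>0"
  proof (rule local_solution[OF F T(1) \<xi>0 X(1) X(2) B(1), of 1])
    show "norm (F \<xi> (w s)) \<le> B" if "norm (\<xi> - \<xi>0) \<le> 1" "0 < s" "s < T" for \<xi> s
      using that T by (intro B(2) image_eqI[of _ _ "(\<xi>, w s)"]) (auto simp: dist_norm norm_minus_commute)
    have "clip_lipschitz * B * T \<le> clip_lipschitz * B * (1 / (clip_lipschitz * B))"
      using clip_lipschitz_ge B by (intro mult_left_mono) (auto simp: T_def)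
    then show "clip_lipschitz * B * T \<le> 1" using clip_lipschitz_ge B by simp
  qed auto
  then show ?thesis using T(1) regular_solution_imp_caratheodory by blast
qed

text \<open>The local existence time \<open>\<rho> / (clip_lipschitz * B)\<close> is the same for every initial state \<open>y\<close> if the
  radius \<open>\<rho>\<close> and the bound \<open>B\<close> are both proportional to \<open>1 + \<parallel>y\<parallel>\<close>.\<close>

theorem solution_exists_globally:
  fixes F :: "'a \<Rightarrow> 'c::real_normed_vector \<Rightarrow> 'a"
  assumes F: "continuous_on UNIV (\<lambda>(\<xi>, w). F \<xi> w)" and w: "w \<in> PC" and \<xi>0: "\<xi>0 \<in> states"
    and M: "M > 0" "\<And>\<xi> v. \<xi> \<in> states \<Longrightarrow> norm (F \<xi> v) \<le> M * (1 + norm (\<xi>, v))"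
    and bdd: "bounded (w ` {0..})"
  shows "\<exists>\<xi>. caratheodory_solution states E F w \<xi> \<and> \<xi> 0 = \<xi>0"
proof -
  obtain X where X: "countable X" "\<And>s. s > 0 \<Longrightarrow> s \<notin> X \<Longrightarrow> isCont w s"
    using PC_isCont[OF w] by blast
  obtain W where W: "W > 0" "\<And>s. s \<ge> 0 \<Longrightarrow> norm (w s) \<le> W"
    using bdd unfolding bounded_pos by auto
  define \<tau> where "\<tau> = 1 / (clip_lipschitz * (M * (2 + W)))"
  have \<tau>: "\<tau> > 0" using M W clip_lipschitz_ge by (simp add: \<tau>_def)
  show ?thesis
  proof (rule caratheodory_solution_by_steps[OF \<tau> \<xi>0])
    fix k y assume y: "y \<in> states"
    let ?r = "norm y"
    let ?B = "M * (2 + W) * (1 + ?r)"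
    let ?c = "real k * \<tau>"
    have c: "0 \<le> ?c" using \<tau> by simp
    show "\<exists>\<eta>. regular_solution states E F (\<lambda>s. w (?c + s)) \<tau> \<eta> \<and> \<eta> 0 = y"
    proof (rule local_solution[OF F \<tau> y, of "(\<lambda>x. x - ?c) ` X" _ ?B "1 + ?r"])
      show "countable ((\<lambda>x. x - ?c) ` X)" using X by simp
      show "isCont (\<lambda>s. w (?c + s)) s" if s: "0 < s" "s \<notin> (\<lambda>x. x - ?c) ` X" for s
      proof -
        have "?c + s \<notin> X" using s(2) by force
        then have "isCont w (?c + s)" using s c by (intro X) auto
        then show ?thesis by (intro isCont_o2[of s "\<lambda>s. ?c + s" w] continuous_intros)
      qed
      show "0 < ?B" using M W by (intro mult_pos_pos) (auto intro: add_pos_nonneg)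
      show "norm (F \<xi> (w (?c + s))) \<le> ?B"
        if \<xi>: "\<xi> \<in> states" "norm (\<xi> - y) \<le> 1 + ?r" "0 < s" for \<xi> s
      proof -
        have "norm (F \<xi> (w (?c + s))) \<le> M * (1 + norm (\<xi>, w (?c + s)))" by (rule M(2)[OF \<xi>(1)])
        also have "\<dots> \<le> M * ((2 + W) * (1 + ?r))"
        proof (rule mult_left_mono)
          have "norm (\<xi>, w (?c + s)) \<le> norm \<xi> + norm (w (?c + s))" by (rule norm_Pair_le)
          moreover have "norm \<xi> \<le> ?r + norm (\<xi> - y)" using norm_triangle_sub[of \<xi> y] by simp
          moreover have "norm (w (?c + s)) \<le> W" using c \<xi> by (intro W) auto
          moreover have "0 \<le> W * ?r" using W by simp
          moreover have "(2 + W) * (1 + ?r) = 2 + W + 2 * ?r + W * ?r" by (simp add: algebra_simps)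
          ultimately show "1 + norm (\<xi>, w (?c + s)) \<le> (2 + W) * (1 + ?r)" using \<xi>(2) by linarith
        qed (use M in simp)
        finally show ?thesis by (simp add: mult.assoc)
      qed
      show "clip_lipschitz * ?B * \<tau> \<le> 1 + ?r"
        using M W clip_lipschitz_ge by (simp add: \<tau>_def)
    qed
  qed
qed

end

theorem corollary10:
  fixes fp :: "real ^ 'n \<Rightarrow> real \<Rightarrow> real ^ 'p \<Rightarrow> real ^ 'n"
    and fc :: "real ^ 'm::{finite,linorder} \<Rightarrow> real \<Rightarrow> real ^ 'm::{finite,linorder}"
    and Gp :: "real ^ 'n ^ 1"
    and k1 k2 :: real
  assumes "k1 < k2"
    and "continuous_on UNIV (\<lambda>(\<xi>, w). closed_loop fp fc Gp \<xi> w)"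
  shows "(\<forall>w\<in>PC. \<forall>\<xi>0\<in>sector_states Gp k1 k2. \<exists>T>0. \<exists>\<xi>.
      caratheodory_solution_on (sector_states Gp k1 k2) controller_directions (closed_loop fp fc Gp) w T \<xi> \<and>
      \<xi> 0 = \<xi>0) \<and>
    ((\<exists>M>0. \<forall>\<xi>\<in>sector_states Gp k1 k2. \<forall>w.
        norm (closed_loop fp fc Gp \<xi> w) \<le> M * (1 + norm (\<xi>, w))) \<longrightarrow>
      (\<forall>\<xi>0\<in>sector_states Gp k1 k2. \<forall>w\<in>PC. bounded (w ` {0..}) \<longrightarrow>
        (\<exists>\<xi>. caratheodory_solution (sector_states Gp k1 k2) controller_directions (closed_loop fp fc Gp) w \<xi> \<and>
          \<xi> 0 = \<xi>0)))"
proof -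
  let ?a = "(0 :: real ^ 'n, axis (Min UNIV) 1 :: real ^ 'm::{finite,linorder})"
  let ?q = "(Gp $ 1, 0 :: real ^ 'm::{finite,linorder})"
  interpret sector_system ?a ?q controller_directions k1 k2
  proof
    show "norm ?a = 1" by (simp add: norm_Pair)
    show "c *\<^sub>R ?a \<in> controller_directions" for c by (simp add: controller_directions_def)
    show "?q \<bullet> y = 0" if "y \<in> controller_directions" for y
      using that by (auto simp: controller_directions_def)
    show "k1 < k2" by (rule assms)
  qed
  have states: "states = sector_states Gp k1 k2"
    unfolding states_def sector_states_def sector_def first_component_def
    by (auto simp: matrix_vector_mul_component inner_axis')
  show ?thesis
    using solution_exists_locally[OF assms(2)] solution_exists_globally[OF assms(2)]
    unfolding states by blast
qed

end
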